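(* Let $k\in\{1,2,\ldots\}$ and let $U\sim\mathrm{CP}(\lambda,\boldsymbol{\mu})$ be a compound Poisson random variable. Define $g_k:(-\pi,\pi]\times[0,1]\to\mathbb{R}$ by $$ g_k(\phi,p)=\frac{1}{\cos\phi-1}\sum_{j=1}^k\frac{\mathrm{Re}[(e^{i\phi}-1)^j]}{j!}\,\frac{1-(1-p)^j}{p}\,\theta_{j-1}-\frac{2^{k}}{k!}\theta_k\,, $$ and let $$ \delta_k=\inf\{g_k(\phi,p):\phi\in(-\pi,\pi],\ p\in[0,1]\}\,. $$ Assume that $\theta_0<\infty$ and $\delta_k>0$. Then $$ M_0^{(K)}(U)\leq2\sqrt{\frac{2}{\delta_k}}\quad\text{ and }\quad M_1^{(K)}(U)\leq\frac{1}{2\delta_k}\left[1+\log^+(\pi\delta_k)\right]\,. $$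
   Context: Compound Poisson distribution: for $\lambda>0$ and a probability distribution $\boldsymbol{\mu}=(\mu_1,\mu_2,\ldots)$ on $\{1,2,\ldots\}$, $U\sim\mathrm{CP}(\lambda,\boldsymbol{\mu})$ means that $U$ is equal in distribution to $\sum_{j=1}^N X_j$, where $N\sim\mathrm{Po}(\lambda)$ is Poisson with mean $\lambda$ and $X_1,X_2,\ldots$ are i.i.d., independent of $N$, with $\mathbb{P}(X_1=k)=\mu_k$. Write $\lambda_j=\lambda\mu_j$ and, for $k=0,1,2,\ldots$, $\theta_k=\sum_{j=1}^\infty j(j-1)\cdots(j-k)\lambda_j$. Stein equation: let $\mathbb{Z}^+=\{0,1,2,\ldots\}$ and $\mathcal{H}_K=\{I(\cdot\leq y):y\in\mathbb{Z}^+\}$. For $h\in\mathcal{H}_K$, let $f_h$ be the bounded solution of $$h(x)-\mathbb{E}h(U)=\sum_{j=1}^\infty j\lambda_jf_h(x+j)-xf_h(x),\qquad x\in\mathbb{Z}^+;$$ this equation does not involve $f_h(0)$, and $f_h$ is considered on $\{1,2,\ldots\}$. For $l=0,1$ let $$M_l^{(K)}(U)=\sup_{h\in\mathcal{H}_K}\ \sup_{x\geq1}|\Delta^lf_h(x)|,$$ where $\Delta f(x)=f(x+1)-f(x)$ and $\Delta^0f=f$. Other conventions: $\log^+$ is the positive part of the natural logarithm. At $\phi=0$ and at $p=0$ the function $g_k$ is defined by continuous extension. That $g_k$ is real-valued means that $\theta_0,\ldots,\theta_k$ are finite. *)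

theory Defs
  imports "HOL-Probability.Probability"
begin

text \<open>
  A distribution on the positive integers is a \<^typ>\<open>nat pmf\<close> with no mass at \<open>0\<close>.
  All series below run over all \<open>j :: nat\<close>; their terms at \<open>j = 0\<close> vanish.
\<close>

definition compound_poisson_pmf :: "real \<Rightarrow> nat pmf \<Rightarrow> nat pmf" where
  "compound_poisson_pmf lam mu =
     bind_pmf (poisson_pmf lam) (\<lambda>n. map_pmf sum_list (replicate_pmf n mu))"

definition compound_poisson_rv :: "'a measure \<Rightarrow> ('a \<Rightarrow> nat) \<Rightarrow> real \<Rightarrow> nat pmf \<Rightarrow> bool" where
  "compound_poisson_rv M U lam mu \<longleftrightarrow>
     U \<in> measurable M (count_space UNIV) \<and>
     distr M (count_space UNIV) U = measure_pmf (compound_poisson_pmf lam mu)"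

text \<open>
  The falling factorial \<open>j (j - 1) \<cdots> (j - i)\<close> is nonnegative at every natural number
  \<open>j\<close> (it vanishes for \<open>j \<le> i\<close>), so the passage to \<^typ>\<open>ennreal\<close> truncates nothing.
\<close>

definition theta :: "real \<Rightarrow> nat pmf \<Rightarrow> nat \<Rightarrow> ennreal" where
  "theta lam mu i = (\<Sum>j. ennreal ((\<Prod>r\<le>i. real j - real r) * (lam * pmf mu j)))"

definition kolmogorov_tests :: "(nat \<Rightarrow> real) set" where
  "kolmogorov_tests = {h. \<exists>y. h = (\<lambda>x. of_bool (x \<le> y))}"

definition stein_equation ::
  "'a measure \<Rightarrow> ('a \<Rightarrow> nat) \<Rightarrow> real \<Rightarrow> nat pmf \<Rightarrow> (nat \<Rightarrow> real) \<Rightarrow> (nat \<Rightarrow> real) \<Rightarrow> bool" where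
  "stein_equation M U lam mu h f \<longleftrightarrow>
     (\<forall>x. h x - integral\<^sup>L M (\<lambda>\<omega>. h (U \<omega>)) =
          (\<Sum>j. real j * (lam * pmf mu j) * f (x + j)) - real x * f x)"

text \<open>
  The equation does not involve \<open>f 0\<close>. Only the values on the positive integers matter;
  setting \<open>f 0 = 0\<close> makes the bounded solution unique as a function on \<^typ>\<open>nat\<close>.
\<close>

definition stein_solution ::
  "'a measure \<Rightarrow> ('a \<Rightarrow> nat) \<Rightarrow> real \<Rightarrow> nat pmf \<Rightarrow> (nat \<Rightarrow> real) \<Rightarrow> (nat \<Rightarrow> real)" where
  "stein_solution M U lam mu h =
     (THE f. f 0 = 0 \<and> bounded (range f) \<and> stein_equation M U lam mu h f)"

definition fwd_diff :: "(nat \<Rightarrow> real) \<Rightarrow> nat \<Rightarrow> real" where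
  "fwd_diff f x = f (x + 1) - f x"

definition stein_factor ::
  "nat \<Rightarrow> 'a measure \<Rightarrow> ('a \<Rightarrow> nat) \<Rightarrow> real \<Rightarrow> nat pmf \<Rightarrow> ereal" where
  "stein_factor l M U lam mu =
     (SUP h\<in>kolmogorov_tests. SUP x\<in>{1..}.
        ereal \<bar>(fwd_diff ^^ l) (stein_solution M U lam mu h) x\<bar>)"

definition g_formula :: "real \<Rightarrow> nat pmf \<Rightarrow> nat \<Rightarrow> real \<times> real \<Rightarrow> real" where
  "g_formula lam mu k = (\<lambda>(\<phi>, p).
     1 / (cos \<phi> - 1) *
       (\<Sum>j = 1..k. Re ((exp (\<i> * complex_of_real \<phi>) - 1) ^ j) / fact j *
          ((1 - (1 - p) ^ j) / p) * enn2real (theta lam mu (j - 1)))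
     - 2 ^ k / fact k * enn2real (theta lam mu k))"

text \<open>
  The formula makes sense for \<open>\<phi> \<noteq> 0\<close> and \<open>p \<noteq> 0\<close>; the remaining values are limits taken
  from within that part of the domain.
\<close>

definition g_fun :: "real \<Rightarrow> nat pmf \<Rightarrow> nat \<Rightarrow> real \<times> real \<Rightarrow> real" where
  "g_fun lam mu k z =
     (if fst z = 0 \<or> snd z = 0
      then Lim (at z within ({-pi<..pi} - {0}) \<times> {0<..1}) (g_formula lam mu k)
      else g_formula lam mu k z)"

definition delta :: "real \<Rightarrow> nat pmf \<Rightarrow> nat \<Rightarrow> real" where
  "delta lam mu k = (INF z\<in>{-pi<..pi} \<times> {0..1}. g_fun lam mu k z)"

definition log_plus :: "real \<Rightarrow> real" where
  "log_plus x = max 0 (ln x)"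

end

theory Submission
  imports Defs
begin

text \<open>
  Write \<open>G w = exp (L w - L 1)\<close> for the generating function of \<open>U\<close>, where \<open>L w = (\<Sum>j. \<lambda>\<^sub>j * w ^ j)\<close>.
  For the test function \<open>z ^ x\<close> the Stein equation is solved by integrating \<open>w ^ (x - 1) * G z / G w\<close>
  along the segment from \<open>z\<close> to \<open>1\<close>, because the derivative of \<open>w ^ x / G w\<close> is the Stein operator in
  disguise. The solution for \<open>I(\<cdot> \<le> y)\<close> is then a Fourier coefficient over \<open>z = exp (\<i> * \<phi>)\<close>.
  A Taylor expansion of \<open>L\<close> about \<open>1\<close> with remainder gives
  \<open>\<bar>G z / G w\<bar> \<le> exp (- \<delta> * p * (1 - cos \<phi>))\<close> at \<open>w = 1 + (1 - p) * (z - 1)\<close>; this is the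
  estimate that \<open>g\<^sub>k\<close> is designed for. Integrating it over \<open>p\<close> and \<open>\<phi>\<close>
  yields both bounds; a difference in \<open>x\<close> contributes the extra factor \<open>(1 - p) * \<bar>z - 1\<bar>\<close>.
\<close>

section \<open>Integral estimates\<close>

text \<open>The M-test makes the partial sums converge uniformly, and a uniform limit preserves
  continuity and commutes with the integral over a compact interval.\<close>

lemma sums_integral_Weierstrass:
  fixes f :: "nat \<Rightarrow> real \<Rightarrow> complex"
  assumes "\<And>n. continuous_on {a..b} (f n)"
    and "\<And>n t. t \<in> {a..b} \<Longrightarrow> norm (f n t) \<le> B n"
    and "summable B"
  shows "continuous_on {a..b} (\<lambda>t. \<Sum>n. f n t)"
    and "(\<lambda>n. integral {a..b} (f n)) sums integral {a..b} (\<lambda>t. \<Sum>n. f n t)"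
proof -
  have ul: "uniform_limit {a..b} (\<lambda>N t. \<Sum>n<N. f n t) (\<lambda>t. \<Sum>n. f n t) sequentially"
    by (rule Weierstrass_m_test[OF assms(2,3)])
  have cont: "continuous_on {a..b} (\<lambda>t. \<Sum>n<N. f n t)" for N
    by (intro continuous_on_sum assms(1))
  show "continuous_on {a..b} (\<lambda>t. \<Sum>n. f n t)"
    by (rule uniform_limit_theorem[OF always_eventually ul]) (auto simp: cont)
  obtain I J where I: "\<And>N. ((\<lambda>t. \<Sum>n<N. f n t) has_integral I N) {a..b}"
    and J: "((\<lambda>t. \<Sum>n. f n t) has_integral J) {a..b}" and lim: "I \<longlonglongrightarrow> J"
    by (rule uniform_limit_integral[OF ul cont]) auto
  have "I N = (\<Sum>n<N. integral {a..b} (f n))" for N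
    using I[of N] by (subst integral_sum[symmetric])
      (auto intro!: integrable_continuous_real assms(1) simp: integral_unique)
  then have "I = (\<lambda>N. \<Sum>n<N. integral {a..b} (f n))" by (rule ext)
  then show "(\<lambda>n. integral {a..b} (f n)) sums integral {a..b} (\<lambda>t. \<Sum>n. f n t)"
    using lim J by (simp add: sums_def integral_unique)
qed

text \<open>Orthogonality of the characters of the circle: for \<open>n \<noteq> 0\<close> the
  antiderivative takes the same value at both ends, since \<open>cis pi\<close> and
  \<open>cis (- pi)\<close> coincide.\<close>

lemma integral_cis_power:
  "integral {-pi..pi} (\<lambda>t. cis t powi n) = (if n = 0 then complex_of_real (2 * pi) else 0)"
proof (cases "n = 0")
  case False
  define F where "F w = exp (\<i> * of_int n * w) / (\<i> * of_int n)" for w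
  have "(F has_field_derivative exp (\<i> * of_int n * w)) (at w)" for w
    unfolding F_def using False by (auto intro!: derivative_eq_intros)
  then have "((\<lambda>t. exp (\<i> * of_int n * complex_of_real t)) has_integral
      F (complex_of_real pi) - F (complex_of_real (- pi))) {-pi..pi}"
    by (intro fundamental_theorem_of_calculus has_vector_derivative_real_field) auto
  then have "((\<lambda>t. cis (of_int n * t)) has_integral
      cis (of_int n * pi) / (\<i> * of_int n) - cis (of_int n * (- pi)) / (\<i> * of_int n)) {-pi..pi}"
    by (simp add: F_def cis_conv_exp mult.assoc)
  moreover have "cis (of_int n * pi) = cis (of_int n * (- pi))"
    unfolding cis_power_int[symmetric] by (metis cis_inverse cis_pi inverse_minus_eq inverse_1)
  ultimately have "((\<lambda>t. cis (of_int n * t)) has_integral 0) {-pi..pi}" by simp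
  then show ?thesis using False by (simp add: cis_power_int integral_unique)
qed (simp add: scaleR_conv_of_real)

text \<open>Pointwise \<open>(1 + a) * exp (- (a * p)) \<le> 1 + a * exp (- (a * p))\<close>, and
  the right side integrates to \<open>2 - exp (- a)\<close>. Unlike \<open>1 / a\<close>, this bound
  stays finite at \<open>a = 0\<close>, the value that occurs at the point \<open>1\<close> of the
  circle.\<close>

lemma integral_exp_bound:
  fixes a :: real
  assumes "a \<ge> 0"
  shows "integral {0..1} (\<lambda>p. exp (- (a * p))) \<le> 2 / (1 + a)"
proof -
  have i: "((\<lambda>p. 1 + a * exp (- (a * p))) has_integral (F 1 - F 0)) {0..1}"
    if "F = (\<lambda>p. p - exp (- (a * p)))" for F :: "real \<Rightarrow> real"
    unfolding that
    by (intro fundamental_theorem_of_calculus)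
       (auto intro!: derivative_eq_intros simp flip: has_real_derivative_iff_has_vector_derivative)
  have "(1 + a) * integral {0..1} (\<lambda>p. exp (- (a * p))) = integral {0..1} (\<lambda>p. (1 + a) * exp (- (a * p)))"
    by simp
  also have "\<dots> \<le> integral {0..1} (\<lambda>p. 1 + a * exp (- (a * p)))"
    using assms by (intro integral_le integrable_continuous_real continuous_intros) (auto simp: algebra_simps)
  also have "\<dots> \<le> 2"
    using integral_unique[OF i[OF refl]] by simp
  finally show ?thesis using assms by (simp add: field_simps)
qed

text \<open>After multiplication by \<open>1 + a\<close> the integrand is at most the derivative of
  \<open>- ((1 - p) * exp (- (a * p)))\<close>, whose integral is exactly \<open>1\<close>.\<close>

lemma integral_one_minus_exp_bound:
  fixes a :: real
  assumes "a \<ge> 0"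
  shows "integral {0..1} (\<lambda>p. (1 - p) * exp (- (a * p))) \<le> 1 / (1 + a)"
proof -
  have i: "((\<lambda>p. exp (- (a * p)) + a * (1 - p) * exp (- (a * p))) has_integral
      (F 1 - F 0)) {0..1}" 
    if "F = (\<lambda>p. - ((1 - p) * exp (- (a * p))))" for F :: "real \<Rightarrow> real"
    unfolding that
    by (intro fundamental_theorem_of_calculus)
       (auto intro!: derivative_eq_intros simp: algebra_simps simp flip: has_real_derivative_iff_has_vector_derivative)
  have "(1 + a) * integral {0..1} (\<lambda>p. (1 - p) * exp (- (a * p)))
      = integral {0..1} (\<lambda>p. (1 + a) * ((1 - p) * exp (- (a * p))))"
    by simp
  also have "\<dots> \<le> integral {0..1} (\<lambda>p. exp (- (a * p)) + a * (1 - p) * exp (- (a * p)))"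
    using assms by (intro integral_le integrable_continuous_real continuous_intros) (auto simp: algebra_simps)
  also have "\<dots> = 1"
    using integral_unique[OF i[OF refl]] by simp
  finally show ?thesis using assms by (simp add: field_simps)
qed

text \<open>Jordan's inequality: \<open>sin\<close> is concave on \<open>{0..pi/2}\<close> and so
  lies above its chord there.\<close>

lemma two_div_pi_le_sin:
  assumes "0 \<le> x" "x \<le> pi / 2"
  shows "2 / pi * x \<le> sin x"
proof -
  have "concave_on {0..pi/2} sin"
    unfolding concave_on_def
  proof (rule f''_ge0_imp_convex)
    show "((\<lambda>x. - sin x) has_real_derivative - cos x) (at x)" for x :: real
      by (auto intro!: derivative_eq_intros)
    show "((\<lambda>x. - cos x) has_real_derivative sin x) (at x)" for x :: real
      by (auto intro!: derivative_eq_intros)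
  qed (auto intro!: sin_ge_zero)
  then have "sin ((1 - t) *\<^sub>R 0 + t *\<^sub>R (pi/2)) \<ge> (1 - t) * sin 0 + t * sin (pi/2)" if "0 \<le> t" "t \<le> 1" for t
    using that by (intro concave_onD) auto
  from this[of "2 / pi * x"] show ?thesis
    using assms by (simp add: field_simps)
qed

lemma one_minus_cos_eq: "1 - cos t = 2 * (sin (t / 2))\<^sup>2" for t :: real
  using cos_double_sin[of "t / 2"] by simp

lemma norm_one_minus_cis: "norm (1 - cis t) = 2 * \<bar>sin (t / 2)\<bar>"
proof -
  have "(norm (1 - cis t))\<^sup>2 = (1 - cos t)\<^sup>2 + (sin t)\<^sup>2"
    by (simp add: cmod_power2)
  also have "\<dots> = 2 * (1 - cos t)"
    using sin_cos_squared_add[of t] by (simp add: power2_eq_square algebra_simps)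
  also have "\<dots> = (2 * \<bar>sin (t / 2)\<bar>)\<^sup>2"
    by (simp add: one_minus_cos_eq power_mult_distrib)
  finally show ?thesis by (rule power2_eq_imp_eq) auto
qed

text \<open>The lower bound makes \<open>1 - cos t\<close> grow at least like a multiple of
  \<open>t\<^sup>2\<close>; the upper bound replaces the chord \<open>norm (1 - cis t)\<close> by
  the arc.\<close>

lemma abs_sin_half_bounds:
  assumes "\<bar>t\<bar> \<le> pi"
  shows "\<bar>t\<bar> / pi \<le> \<bar>sin (t / 2)\<bar>" "2 * \<bar>sin (t / 2)\<bar> \<le> \<bar>t\<bar>"
proof -
  have "2 / pi * (\<bar>t\<bar> / 2) \<le> sin (\<bar>t\<bar> / 2)"
    using assms by (intro two_div_pi_le_sin) auto
  then show "\<bar>t\<bar> / pi \<le> \<bar>sin (t / 2)\<bar>"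
    by (cases "t \<ge> 0") auto
  show "2 * \<bar>sin (t / 2)\<bar> \<le> \<bar>t\<bar>"
    using abs_sin_x_le_abs_x[of "t / 2"] by simp
qed

text \<open>The bound is the integral over the whole line: \<open>arctan\<close> is replaced by its
  limit \<open>pi / 2\<close>.\<close>

lemma integral_arctan_bound:
  assumes "c > 0"
  shows "integral {-pi..pi} (\<lambda>t. 2 / (1 + c * t\<^sup>2)) \<le> 2 * pi / sqrt c"
proof -
  define F where "F t = 2 / sqrt c * arctan (sqrt c * t)" for t
  have pos: "1 + c * t\<^sup>2 \<noteq> 0" for t
    using assms by (smt (verit) mult_nonneg_nonneg zero_le_power2)
  have sqrt: "sqrt c * 2 * sqrt c = 2 * c"
    using assms by simp
  have "((\<lambda>t. 2 / (1 + c * t\<^sup>2)) has_integral (F pi - F (-pi))) {-pi..pi}"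
    unfolding F_def using assms pos
    by (intro fundamental_theorem_of_calculus)
       (auto intro!: derivative_eq_intros simp: power_mult_distrib inverse_eq_divide sqrt
         simp flip: has_real_derivative_iff_has_vector_derivative)
  then have "integral {-pi..pi} (\<lambda>t. 2 / (1 + c * t\<^sup>2)) = F pi - F (-pi)"
    by (rule integral_unique)
  also have "\<dots> = 4 / sqrt c * arctan (sqrt c * pi)"
    by (simp add: F_def arctan_minus)
  also have "\<dots> \<le> 4 / sqrt c * (pi / 2)"
    using assms arctan_ubound by (intro mult_left_mono) (auto intro: less_imp_le)
  finally show ?thesis by simp
qed

text \<open>Without the absolute value the antiderivative is
  \<open>ln (1 + c * t\<^sup>2) / (2 * c)\<close>, so the interval is split at
  \<open>0\<close>.\<close>

lemma has_integral_log_kernel: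
  assumes "c > 0"
  shows "((\<lambda>t. \<bar>t\<bar> / (1 + c * t\<^sup>2)) has_integral (ln (1 + c * pi\<^sup>2) / c)) {-pi..pi}"
proof -
  define F where "F t = ln (1 + c * t\<^sup>2) / (2 * c)" for t
  have pos: "1 + c * t\<^sup>2 > 0" for t
    using assms by (smt (verit) mult_nonneg_nonneg zero_le_power2)
  have d: "(F has_real_derivative t / (1 + c * t\<^sup>2)) (at t within S)" for t S
    unfolding F_def using assms pos[of t]
    by (auto intro!: derivative_eq_intros)
  have "((\<lambda>t. t / (1 + c * t\<^sup>2)) has_integral (F pi - F 0)) {0..pi}"
    using d by (intro fundamental_theorem_of_calculus) (auto simp flip: has_real_derivative_iff_has_vector_derivative)
  then have r: "((\<lambda>t. \<bar>t\<bar> / (1 + c * t\<^sup>2)) has_integral (F pi - F 0)) {0..pi}"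
    by (rule has_integral_eq[rotated]) auto
  have "((\<lambda>t. t / (1 + c * t\<^sup>2)) has_integral (F 0 - F (-pi))) {-pi..0}"
    using d by (intro fundamental_theorem_of_calculus) (auto simp flip: has_real_derivative_iff_has_vector_derivative)
  from has_integral_neg[OF this]
  have "((\<lambda>t. - (t / (1 + c * t\<^sup>2))) has_integral (F (-pi) - F 0)) {-pi..0}"
    by simp
  then have l: "((\<lambda>t. \<bar>t\<bar> / (1 + c * t\<^sup>2)) has_integral (F (-pi) - F 0)) {-pi..0}"
    by (rule has_integral_eq[rotated]) auto
  have "((\<lambda>t. \<bar>t\<bar> / (1 + c * t\<^sup>2)) has_integral ((F (-pi) - F 0) + (F pi - F 0))) {-pi..pi}"
    by (rule has_integral_combine[OF _ _ l r]) auto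
  moreover have "(F (-pi) - F 0) + (F pi - F 0) = ln (1 + c * pi\<^sup>2) / c"
    using assms by (simp add: F_def field_simps)
  ultimately show ?thesis by simp
qed

text \<open>For \<open>x > 1\<close> factor out \<open>x\<close> and use
  \<open>ln (1 + 1 / x) \<le> 1\<close>; otherwise \<open>ln (1 + x) \<le> x \<le> 1\<close>. This
  gives the second bound of the theorem its shape.\<close>

lemma ln_one_plus_le_log_plus:
  assumes "x > 0"
  shows "ln (1 + x) \<le> 1 + log_plus x"
proof (cases "x \<le> 1")
  case True
  have "ln (1 + x) \<le> x" using assms by (intro ln_add_one_self_le_self) auto
  also have "\<dots> \<le> 1 + log_plus x" using True by (simp add: log_plus_def)
  finally show ?thesis .
next
  case False
  have "1 + x = x * (1 + 1 / x)" using assms by (simp add: field_simps)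
  then have "ln (1 + x) = ln x + ln (1 + 1 / x)"
    using assms by (simp add: ln_mult_pos add_pos_pos)
  also have "ln (1 + 1 / x) \<le> 1 / x"
    using assms by (intro ln_add_one_self_le_self) auto
  also have "1 / x \<le> 1" using False by simp
  finally show ?thesis by (simp add: log_plus_def)
qed

section \<open>Solving the Stein equation by generating functions\<close>

text \<open>Here \<open>r j\<close> stands for \<open>\<lambda>\<^sub>j\<close>, and
  \<open>summable_mean\<close> expresses that \<open>\<theta>\<^sub>0\<close> is finite; it makes
  \<open>L\<close> differentiable up to the unit circle.\<close>

locale jump_rates =
  fixes r :: "nat \<Rightarrow> real"
  assumes r_nonneg: "r j \<ge> 0" and r_0: "r 0 = 0"
    and summable_mean: "summable (\<lambda>j. real j * r j)"
begin

section \<open>The exponent \<open>L\<close> on the closed unit disc\<close>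

lemma summable_r: "summable r"
proof (rule summable_comparison_test_ev[OF always_eventually summable_mean], intro allI)
  show "norm (r j) \<le> real j * r j" for j
    using r_nonneg[of j] r_0 by (cases j) (auto simp: algebra_simps)
qed

definition L :: "complex \<Rightarrow> complex" where
  "L w = (\<Sum>j. of_real (r j) * w ^ j)"

definition dL :: "complex \<Rightarrow> complex" where
  "dL w = (\<Sum>j. of_real (real j * r j) * w ^ (j - 1))"

lemma L_sums: "norm w \<le> 1 \<Longrightarrow> (\<lambda>j. of_real (r j) * w ^ j) sums L w"
  unfolding L_def
  by (intro summable_sums summable_comparison_test_ev[OF always_eventually summable_r])
     (auto simp: norm_mult norm_power r_nonneg mult_left_le power_le_one)

lemma dL_sums: "norm w \<le> 1 \<Longrightarrow> (\<lambda>j. of_real (real j * r j) * w ^ (j - 1)) sums dL w"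
  unfolding dL_def
  by (intro summable_sums summable_comparison_test_ev[OF always_eventually summable_mean])
     (auto simp: norm_mult norm_power r_nonneg mult_left_le power_le_one)

text \<open>The derivative is taken relative to the closed disc, because the points of interest lie
  on its boundary. The termwise derivatives converge uniformly there, with
  \<open>real j * r j\<close> as dominating series.\<close>

lemma L_has_derivative:
  assumes "norm w \<le> 1"
  shows "(L has_field_derivative dL w) (at w within cball 0 1)"
proof -
  have "\<exists>g. \<forall>w\<in>cball 0 1. (\<lambda>j. of_real (r j) * w ^ j) sums g w \<and>
      (g has_field_derivative dL w) (at w within cball 0 1)"
  proof (rule has_field_derivative_series)
    show "((\<lambda>w. of_real (r j) * w ^ j) has_field_derivative of_real (real j * r j) * w ^ (j - 1))
        (at w within cball 0 1)" for j and w :: complex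
      by (auto intro!: derivative_eq_intros)
    show "uniform_limit (cball 0 1) (\<lambda>n w. \<Sum>j<n. of_real (real j * r j) * w ^ (j - 1)) dL sequentially"
      unfolding dL_def[abs_def]
      by (rule Weierstrass_m_test[OF _ summable_mean])
         (auto simp: norm_mult norm_power r_nonneg mult_left_le power_le_one)
    show "(0::complex) \<in> cball 0 1" by simp
    show "summable (\<lambda>j. of_real (r j) * (0::complex) ^ j)"
      using L_sums[of 0] by (auto simp: sums_iff)
  qed simp
  then obtain g where g: "\<And>w. w \<in> cball 0 1 \<Longrightarrow> (\<lambda>j. of_real (r j) * w ^ j) sums g w"
      "\<And>w. w \<in> cball 0 1 \<Longrightarrow> (g has_field_derivative dL w) (at w within cball 0 1)"
    by blast
  have "g w = L w" if "w \<in> cball 0 1" for w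
    using g(1)[OF that] L_sums[of w] that by (auto simp: sums_iff)
  then show ?thesis
    using g(2)[of w] assms by (subst has_field_derivative_cong_ev) (auto simp: eventually_at_filter)
qed

lemma continuous_L: "continuous_on (cball 0 1) L"
  by (rule DERIV_continuous_on) (use L_has_derivative in auto)

text \<open>Parametrises the segment from \<open>z\<close> at \<open>p = 0\<close> to
  \<open>1\<close> at \<open>p = 1\<close>. By convexity it stays in the closed disc.\<close>

definition W :: "complex \<Rightarrow> real \<Rightarrow> complex" where
  "W z p = z + of_real p * (1 - z)"

lemma W_0 [simp]: "W z 0 = z" and W_1 [simp]: "W z 1 = 1"
  by (simp_all add: W_def)

lemma W_minus_1: "W z p - 1 = of_real (1 - p) * (z - 1)"
  by (simp add: W_def algebra_simps)

lemma norm_W_le: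
  assumes "norm z \<le> 1" "0 \<le> p" "p \<le> 1"
  shows "norm (W z p) \<le> 1"
proof -
  have "W z p = (1 - p) *\<^sub>R z + p *\<^sub>R 1"
    by (simp add: W_def algebra_simps scaleR_conv_of_real)
  also have "\<dots> \<in> cball 0 1"
    using assms by (intro convexD) auto
  finally show ?thesis by simp
qed

text \<open>
  The solution for the test function \<open>z ^ x\<close> is \<open>(1 - z) * \<Psi> x z\<close>. Dividing by \<open>1 - z\<close> turns
  Taylor coefficients into their partial sums, so the solution for \<open>I(\<cdot> \<le> y)\<close> is the
  \<open>y\<close>-th Taylor coefficient of \<open>\<Psi> x\<close>.
\<close>

definition E :: "nat \<Rightarrow> complex \<Rightarrow> real \<Rightarrow> complex" where
  "E x z p = W z p ^ (x - 1) * exp (L z - L (W z p))"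

definition \<Psi> :: "nat \<Rightarrow> complex \<Rightarrow> complex" where
  "\<Psi> x z = integral {0..1} (E x z)"

section \<open>Continuity and crude bounds for \<open>E\<close> and \<open>\<Psi>\<close>\<close>

lemma continuous_E2:
  "continuous_on (cball 0 1 \<times> {0..1}) (\<lambda>(z, p). E x z p)"
  unfolding E_def case_prod_beta W_def
  by (intro continuous_intros continuous_on_compose2[OF continuous_L])
     (auto simp flip: W_def simp: norm_W_le)

lemma continuous_E: "norm z \<le> 1 \<Longrightarrow> continuous_on {0..1} (E x z)"
  using continuous_on_compose2[OF continuous_E2, of "{0..1}" "\<lambda>p. (z, p)" x]
  by (simp add: continuous_on_Pair image_subset_iff)

lemma continuous_\<Psi>: "continuous_on (cball 0 1) (\<Psi> x)"
  unfolding \<Psi>_def[abs_def]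
  using integral_continuous_on_param[of "cball 0 1" 0 1 "E x"] continuous_E2 by simp

lemma continuous_\<Psi>_cis: "continuous_on A (\<lambda>t. \<Psi> x (cis t))"
  by (rule continuous_on_compose2[OF continuous_\<Psi>]) (auto intro!: continuous_intros)

text \<open>Both values of \<open>L\<close> are at most \<open>suminf r\<close> in norm. The
  resulting constant serves to dominate the series when sums and integrals are exchanged.\<close>

lemma norm_exp_L_le:
  assumes "norm z \<le> 1" "norm w \<le> 1"
  shows "norm (exp (L z - L w)) \<le> exp (2 * suminf r)"
proof -
  have L: "norm (L w) \<le> suminf r" if "norm w \<le> 1" for w
    unfolding L_def
    by (rule norm_suminf_le[OF _ summable_r])
       (use that in \<open>auto simp: norm_mult norm_power r_nonneg mult_left_le power_le_one\<close>)
  have "norm (L z - L w) \<le> 2 * suminf r"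
    using norm_triangle_ineq4[of "L z" "L w"] L[OF assms(1)] L[OF assms(2)] by linarith
  then show ?thesis
    using norm_exp[of "L z - L w"] by (meson exp_le_cancel_iff order_trans)
qed

lemma norm_E_le:
  assumes "norm z \<le> 1" "0 \<le> p" "p \<le> 1"
  shows "norm (E x z p) \<le> exp (2 * suminf r)"
  unfolding E_def norm_mult norm_power
  using norm_W_le[OF assms] norm_exp_L_le[OF assms(1) norm_W_le[OF assms]]
  by (metis exp_ge_zero mult_mono' mult_1 norm_ge_zero power_le_one zero_le_power)

lemma norm_\<Psi>_le:
  assumes "norm z \<le> 1"
  shows "norm (\<Psi> x z) \<le> exp (2 * suminf r)"
proof -
  have "norm (\<Psi> x z) \<le> exp (2 * suminf r) * (1 - 0)"
    unfolding \<Psi>_def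
    by (rule integral_bound) (use assms norm_E_le continuous_E in auto)
  then show ?thesis by simp
qed

text \<open>Sum and integral are exchanged; under the integral the powers of \<open>W z p\<close>
  are those of the series \<open>dL\<close>, multiplied by \<open>W z p ^ x\<close>.\<close>

lemma \<Psi>_jump_sums:
  assumes "norm z \<le> 1"
  shows "(\<lambda>j. of_real (real j * r j) * \<Psi> (x + j) z) sums
    integral {0..1} (\<lambda>p. W z p ^ x * dL (W z p) * exp (L z - L (W z p)))"
proof -
  have "(\<lambda>j. integral {0..1} (\<lambda>p. of_real (real j * r j) * E (x + j) z p)) sums
      integral {0..1} (\<lambda>p. \<Sum>j. of_real (real j * r j) * E (x + j) z p)"
  proof (rule sums_integral_Weierstrass)
    show "summable (\<lambda>j. real j * r j * exp (2 * suminf r))"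
      by (intro summable_mult2 summable_mean)
    show "norm (of_real (real j * r j) * E (x + j) z p) \<le> real j * r j * exp (2 * suminf r)"
      if "p \<in> {0..1}" for j p
      unfolding norm_mult using norm_E_le[of z p "x + j"] assms that
      by (intro mult_mono) (auto simp: r_nonneg simp del: of_real_mult)
  qed (intro continuous_intros continuous_E assms)
  also have "integral {0..1} (\<lambda>p. \<Sum>j. of_real (real j * r j) * E (x + j) z p) =
      integral {0..1} (\<lambda>p. W z p ^ x * dL (W z p) * exp (L z - L (W z p)))"
  proof (rule integral_cong)
    fix p :: real assume p: "p \<in> {0..1}"
    \<comment> \<open>At \<open>j = 0\<close> truncated subtraction breaks the match of the
      exponents, but the factor \<open>real j\<close> makes both sides zero.\<close>
    have "of_real (real j * r j) * E (x + j) z p =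
        (W z p ^ x * exp (L z - L (W z p))) * (of_real (real j * r j) * W z p ^ (j - 1))" for j
      by (cases j) (auto simp: E_def power_add)
    moreover have "(\<lambda>j. (W z p ^ x * exp (L z - L (W z p))) * (of_real (real j * r j) * W z p ^ (j - 1)))
        sums (W z p ^ x * exp (L z - L (W z p)) * dL (W z p))"
      using p assms by (intro sums_mult dL_sums norm_W_le) auto
    ultimately have "(\<lambda>j. of_real (real j * r j) * E (x + j) z p) sums
        (W z p ^ x * exp (L z - L (W z p)) * dL (W z p))"
      by (simp only:)
    then show "(\<Sum>j. of_real (real j * r j) * E (x + j) z p) =
        W z p ^ x * dL (W z p) * exp (L z - L (W z p))"
      by (simp only: sums_unique[symmetric] mult_ac)
  qed
  finally show ?thesis by (simp add: \<Psi>_def)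
qed

text \<open>The fundamental theorem of calculus for \<open>w ^ x * exp (L z - L w)\<close> along the
  segment: the end values give the right side, and the two terms of the product rule give the two
  parts of the Stein operator. For \<open>x = 0\<close> the truncated exponent \<open>x - 1\<close>
  does no harm, as its term carries the factor \<open>x\<close>.\<close>

lemma \<Psi>_stein:
  assumes "norm z \<le> 1"
  shows "(1 - z) * ((\<Sum>j. of_real (real j * r j) * \<Psi> (x + j) z) - of_nat x * \<Psi> x z) = z ^ x - exp (L z - L 1)"
proof -
  define F where "F w = w ^ x * exp (L z - L w)" for w
  define D where "D w = of_nat x * w ^ (x - 1) * exp (L z - L w) - w ^ x * dL w * exp (L z - L w)" for w
  have F: "(F has_field_derivative D w) (at w within cball 0 1)" if "norm w \<le> 1" for w
    unfolding F_def D_def using that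
    by (auto intro!: derivative_eq_intros L_has_derivative simp: algebra_simps)
  have "((\<lambda>p. (1 - z) * D (W z p)) has_integral (F (W z 1) - F (W z 0))) {0..1}"
  proof (rule fundamental_theorem_of_calculus)
    fix p :: real assume p: "p \<in> {0..1}"
    have "(W z has_vector_derivative (1 - z)) (at p within {0..1})"
      unfolding W_def by (auto intro!: derivative_eq_intros)
    moreover have "(F has_field_derivative D (W z p)) (at (W z p) within W z ` {0..1})"
      using p assms by (intro DERIV_subset[OF F]) (auto simp: norm_W_le)
    ultimately show "((\<lambda>p. F (W z p)) has_vector_derivative (1 - z) * D (W z p)) (at p within {0..1})"
      using field_vector_diff_chain_within[of "W z" "1 - z" p "{0..1}" F] by (simp add: o_def)
  qed simp
  then have FTC: "((\<lambda>p. (1 - z) * D (W z p)) has_integral (exp (L z - L 1) - z ^ x)) {0..1}"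
    by (simp add: F_def)
  have sums: "(\<Sum>j. of_real (real j * r j) * \<Psi> (x + j) z) =
      integral {0..1} (\<lambda>p. W z p ^ x * dL (W z p) * exp (L z - L (W z p)))"
    using \<Psi>_jump_sums[OF assms] by (simp add: sums_iff)
  show ?thesis
  proof (cases "z = 1")
    case False
    then have "((\<lambda>p. D (W z p)) has_integral ((exp (L z - L 1) - z ^ x) / (1 - z))) {0..1}"
      using has_integral_mult_right[OF FTC, of "1 / (1 - z)"] by simp
    moreover have "((\<lambda>p. of_nat x * E x z p) has_integral of_nat x * \<Psi> x z) {0..1}"
      unfolding \<Psi>_def using assms
      by (intro has_integral_mult_right integrable_integral integrable_continuous_real continuous_E)
    ultimately have "((\<lambda>p. of_nat x * E x z p - D (W z p)) has_integral
        (of_nat x * \<Psi> x z - (exp (L z - L 1) - z ^ x) / (1 - z))) {0..1}"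
      by (intro has_integral_diff)
    moreover have "of_nat x * E x z p - D (W z p) = W z p ^ x * dL (W z p) * exp (L z - L (W z p))" for p
      by (simp add: E_def D_def)
    ultimately show ?thesis
      using False unfolding sums by (simp add: integral_unique field_simps)
  qed auto
qed

text \<open>The \<open>y\<close>-th Fourier coefficient of \<open>\<Psi> x\<close> on the unit
  circle. Taking the real part yields a real function without a proof that the coefficient is real;
  the Stein equation has real coefficients and survives this.\<close>

definition stein_sol :: "nat \<Rightarrow> nat \<Rightarrow> real" where
  "stein_sol y x = Re (integral {-pi..pi} (\<lambda>t. cis t powi (- int y) * \<Psi> x (cis t))) / (2 * pi)"

end

text \<open>The law \<open>q\<close> of \<open>U\<close> enters through its generating function on
  the closed disc. That compound Poisson laws satisfy \<open>pgf\<close> is shown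
  separately.\<close>

locale jump_rates_law = jump_rates r for r +
  fixes q :: "nat pmf"
  assumes pgf: "norm z \<le> 1 \<Longrightarrow> (\<lambda>m. of_real (pmf q m) * z ^ m) sums exp (L z - L 1)"
begin

section \<open>Finiteness of the mean of \<open>q\<close>\<close>

lemma summable_pmf: "summable (pmf q)"
  using pgf[of 1] summable_of_real_iff[of "pmf q", where 'a = complex] by (auto simp: sums_iff)

text \<open>For \<open>0 < s < 1\<close> the expectation of \<open>1 - s ^ m\<close> under
  \<open>q\<close> is \<open>1 - exp (L s - L 1) \<le> L 1 - L s \<le> (1 - s) * (\<Sum>j. real j *
  r j)\<close>. Divide by \<open>1 - s\<close> and let \<open>s\<close> tend to
  \<open>1\<close>.\<close>

lemma pmf_mean_partial_sum: "(\<Sum>m\<le>N. real m * pmf q m) \<le> (\<Sum>j. real j * r j)"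
proof -
  \<comment> \<open>The inner sum is \<open>(1 - s ^ m) / (1 - s)\<close> and tends to
    \<open>m\<close>.\<close>
  have "(\<Sum>m\<le>N. pmf q m * (\<Sum>i<m. s ^ i)) \<le> (\<Sum>j. real j * r j)" if s: "0 < s" "s < 1" for s :: real
  proof -
    have sL: "(\<lambda>j. r j * s ^ j) sums Re (L (of_real s))"
      using sums_Re[OF L_sums[of "of_real s"]] s by (simp flip: of_real_power)
    have s1: "r sums Re (L 1)"
      using sums_Re[OF L_sums[of 1]] by simp
    \<comment> \<open>On the real axis \<open>L\<close> is real, so \<open>pgf\<close> becomes an
      identity between real numbers.\<close>
    have "L (of_real u) = of_real (Re (L (of_real u)))" if "0 < u" "u \<le> 1" for u
      using sums_Im[OF L_sums[of "of_real u"]] that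
      by (intro complex_eqI) (auto simp flip: of_real_power simp: sums_iff)
    from this[of 1] this[of s] s have Le: "L (of_real s) - L 1 = of_real (Re (L (of_real s)) - Re (L 1))"
      by simp
    have ps: "(\<lambda>m. pmf q m * s ^ m) sums exp (Re (L (of_real s)) - Re (L 1))"
      using sums_Re[OF pgf[of "of_real s"]] s
      unfolding Le exp_of_real by (simp flip: of_real_power)
    have p1: "pmf q sums 1"
      using sums_Re[OF pgf[of 1]] by simp
    have "(\<lambda>m. pmf q m * (1 - s ^ m)) sums (1 - exp (Re (L (of_real s)) - Re (L 1)))"
      using sums_diff[OF p1 ps] by (simp add: algebra_simps)
    then have "(\<Sum>m\<le>N. pmf q m * (1 - s ^ m)) \<le> 1 - exp (Re (L (of_real s)) - Re (L 1))"
      using s sum_le_suminf[of "\<lambda>m. pmf q m * (1 - s ^ m)" "{..N}"] by (auto simp: sums_iff power_le_one)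
    also have "\<dots> \<le> Re (L 1) - Re (L (of_real s))"
      using exp_ge_add_one_self[of "Re (L (of_real s)) - Re (L 1)"] by linarith
    also have "\<dots> \<le> (\<Sum>j. (1 - s) * (real j * r j))"
    proof (rule sums_le[OF _ sums_diff[OF s1 sL] summable_sums])
      show "r j - r j * s ^ j \<le> (1 - s) * (real j * r j)" for j
      proof -
        have "1 - s ^ j = (1 - s) * (\<Sum>i<j. s ^ i)" by (rule one_diff_power_eq)
        also have "\<dots> \<le> (1 - s) * (\<Sum>i<j. 1)"
          using s by (intro mult_left_mono sum_mono power_le_one) auto
        finally have "r j * (1 - s ^ j) \<le> r j * ((1 - s) * real j)"
          using r_nonneg[of j] by (intro mult_left_mono) auto
        then show ?thesis by (simp add: algebra_simps)
      qed
    qed (intro summable_mult summable_mean)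
    also have "\<dots> = (1 - s) * (\<Sum>j. real j * r j)"
      by (intro suminf_mult summable_mean)
    finally have "(1 - s) * (\<Sum>m\<le>N. pmf q m * (\<Sum>i<m. s ^ i)) \<le> (1 - s) * (\<Sum>j. real j * r j)"
      by (simp only: one_diff_power_eq sum_distrib_left mult.left_commute)
    then show ?thesis using s by simp
  qed
  then have "\<forall>\<^sub>F s in at_left 1. (\<Sum>m\<le>N. pmf q m * (\<Sum>i<m. s ^ i)) \<le> (\<Sum>j. real j * r j)"
    by (intro eventually_at_leftI[of 0]) auto
  moreover have "((\<lambda>s. \<Sum>m\<le>N. pmf q m * (\<Sum>i<m. s ^ i)) \<longlongrightarrow> (\<Sum>m\<le>N. pmf q m * (\<Sum>i<m. 1 ^ i))) (at_left 1)"
    by (intro tendsto_intros)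
  ultimately have "(\<Sum>m\<le>N. pmf q m * (\<Sum>i<m. 1 ^ i)) \<le> (\<Sum>j. real j * r j)"
    by (intro tendsto_upperbound[of _ _ "at_left (1::real)"]) auto
  then show ?thesis by (simp add: mult.commute)
qed

lemma summable_pmf_mean: "summable (\<lambda>m. real m * pmf q m)"
  by (rule bounded_imp_summable[OF _ pmf_mean_partial_sum]) auto

text \<open>The quotient of \<open>z ^ x - exp (L z - L 1)\<close> by \<open>1 - z\<close>, expanded
  into geometric sums so that nothing is singular at \<open>z = 1\<close>. The series converges
  because \<open>q\<close> has finite mean.\<close>

definition K :: "nat \<Rightarrow> complex \<Rightarrow> complex" where
  "K x z = (\<Sum>m. of_real (pmf q m) * ((\<Sum>i<m. z ^ i) - (\<Sum>i<x. z ^ i)))"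

lemma norm_K_term_le:
  fixes z :: complex
  assumes "norm z \<le> 1"
  shows "norm (of_real (pmf q m) * ((\<Sum>i<m. z ^ i) - (\<Sum>i<x. z ^ i))) \<le> real m * pmf q m + real x * pmf q m"
proof -
  have S: "norm (\<Sum>i<m. z ^ i) \<le> real m" for m
  proof -
    have "norm (z ^ i) \<le> 1" for i
      using assms by (simp add: norm_power power_le_one)
    then show ?thesis
      using sum_norm_le[of "{..<m}" "\<lambda>i. z ^ i" "\<lambda>_. 1"] by simp
  qed
  have "norm ((\<Sum>i<m. z ^ i) - (\<Sum>i<x. z ^ i)) \<le> real m + real x"
    using norm_triangle_ineq4[of "\<Sum>i<m. z ^ i" "\<Sum>i<x. z ^ i"] S[of m] S[of x] by linarith
  then have "pmf q m * norm ((\<Sum>i<m. z ^ i) - (\<Sum>i<x. z ^ i)) \<le> pmf q m * (real m + real x)"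
    by (intro mult_left_mono) auto
  then show ?thesis by (simp add: norm_mult distrib_left mult.commute)
qed

lemma summable_K_bound: "summable (\<lambda>m. real m * pmf q m + real x * pmf q m)"
  by (intro summable_add summable_mult summable_pmf summable_pmf_mean)

lemma K_eq:
  assumes "norm z \<le> 1"
  shows "(1 - z) * K x z = z ^ x - exp (L z - L 1)"
proof -
  have "(\<lambda>m. of_real (pmf q m) * ((\<Sum>i<m. z ^ i) - (\<Sum>i<x. z ^ i))) sums K x z"
    unfolding K_def using assms norm_K_term_le[OF assms]
    by (intro summable_sums summable_comparison_test_ev[OF always_eventually summable_K_bound]) blast
  from sums_mult[OF this, of "1 - z"]
  have "(\<lambda>m. of_real (pmf q m) * ((1 - z) * (\<Sum>i<m. z ^ i) - (1 - z) * (\<Sum>i<x. z ^ i))) sums ((1 - z) * K x z)"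
    by (simp add: algebra_simps)
  then have 1: "(\<lambda>m. of_real (pmf q m) * (z ^ x - z ^ m)) sums ((1 - z) * K x z)"
    by (simp flip: one_diff_power_eq)
  have "(\<lambda>m. of_real (pmf q m) * z ^ x - of_real (pmf q m) * z ^ m) sums (1 * z ^ x - exp (L z - L 1))"
    using pgf[of 1] by (intro sums_diff sums_mult2 pgf assms) simp
  then have "(\<lambda>m. of_real (pmf q m) * (z ^ x - z ^ m)) sums (z ^ x - exp (L z - L 1))"
    by (simp add: algebra_simps)
  with 1 show ?thesis by (rule sums_unique2)
qed

text \<open>By orthogonality the \<open>y\<close>-th Fourier coefficient of a geometric sum with
  \<open>m\<close> terms is \<open>of_bool (y < m)\<close>. The difference of two such sums produces
  the centred test function.\<close>

lemma integral_K:
  "(\<lambda>m. of_real (2 * pi * (pmf q m * (of_bool (x \<le> y) - of_bool (m \<le> y)))))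
     sums integral {-pi..pi} (\<lambda>t. cis t powi (- int y) * K x (cis t))"
proof -
  define T where "T m z = of_real (pmf q m) * ((\<Sum>i<m. z ^ i) - (\<Sum>i<x. z ^ i))" for m and z :: complex
  have c: "continuous_on A (\<lambda>t. cis t powi n)" for A n
    by (simp add: cis_power_int) (intro continuous_intros)
  have pw: "cis t powi (- int y) * cis t ^ i = cis t powi (int i - int y)" for t i
    unfolding cis_power_int Complex.DeMoivre cis_mult by (rule arg_cong[where f = cis]) (simp add: algebra_simps)
  have "(\<lambda>m. integral {-pi..pi} (\<lambda>t. cis t powi (- int y) * T m (cis t))) sums
      integral {-pi..pi} (\<lambda>t. \<Sum>m. cis t powi (- int y) * T m (cis t))"
  proof (rule sums_integral_Weierstrass[OF _ _ summable_K_bound])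
    show "norm (cis t powi (- int y) * T m (cis t)) \<le> real m * pmf q m + real x * pmf q m" for m t
      using norm_K_term_le[of "cis t" m x] by (simp add: norm_mult norm_power_int T_def)
  qed (auto simp: T_def intro!: continuous_intros c)
  moreover have "integral {-pi..pi} (\<lambda>t. cis t powi (- int y) * T m (cis t)) =
      of_real (2 * pi * (pmf q m * (of_bool (x \<le> y) - of_bool (m \<le> y))))" for m
  proof -
    have p: "integral {-pi..pi} (\<lambda>t. cis t powi (- int y) * (\<Sum>i<m. cis t ^ i)) = of_real (2 * pi * of_bool (y < m))" for m
    proof -
      have "integral {-pi..pi} (\<lambda>t. cis t powi (- int y) * (\<Sum>i<m. cis t ^ i)) =
          integral {-pi..pi} (\<lambda>t. \<Sum>i<m. cis t powi (int i - int y))"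
        unfolding sum_distrib_left pw ..
      also have "\<dots> = (\<Sum>i<m. integral {-pi..pi} (\<lambda>t. cis t powi (int i - int y)))"
        by (intro integral_sum integrable_continuous_real c) auto
      also have "\<dots> = (\<Sum>i<m. if i = y then of_real (2 * pi) else 0)"
        by (intro sum.cong) (auto simp: integral_cis_power)
      finally show ?thesis by (simp add: sum.delta)
    qed
    have ci: "(\<lambda>t. of_real a * (cis t powi (- int y) * (\<Sum>i<m. cis t ^ i))) integrable_on {-pi..pi}" for a m
      by (intro integrable_continuous_real continuous_intros c)
    have "integral {-pi..pi} (\<lambda>t. cis t powi (- int y) * T m (cis t)) =
        integral {-pi..pi} (\<lambda>t. of_real (pmf q m) * (cis t powi (- int y) * (\<Sum>i<m. cis t ^ i)) -
          of_real (pmf q m) * (cis t powi (- int y) * (\<Sum>i<x. cis t ^ i)))"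
      by (intro integral_cong) (simp add: T_def algebra_simps)
    also have "\<dots> = of_real (pmf q m) * of_real (2 * pi * of_bool (y < m)) - of_real (pmf q m) * of_real (2 * pi * of_bool (y < x))"
      by (simp only: integral_diff[OF ci ci] integral_mult_right p)
    also have "\<dots> = of_real (2 * pi * (pmf q m * (of_bool (y < m) - of_bool (y < x))))"
      by (simp add: right_diff_distrib)
    also have "of_bool (y < m) - of_bool (y < x) = (of_bool (x \<le> y) - of_bool (m \<le> y) :: real)"
      by (auto simp: not_le)
    finally show ?thesis .
  qed
  moreover have "(\<Sum>m. cis t powi (- int y) * T m (cis t)) = cis t powi (- int y) * K x (cis t)" for t
    unfolding K_def T_def using norm_K_term_le[of "cis t" _ x]
    by (intro suminf_mult summable_comparison_test_ev[OF always_eventually summable_K_bound[of x]]) auto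
  ultimately show ?thesis by simp
qed

text \<open>Divide the identity \<open>\<Psi>_stein\<close> by \<open>1 - z\<close>, so that its
  right side becomes \<open>K x z\<close>, and compare the \<open>y\<close>-th Fourier coefficients
  of both sides.\<close>

lemma stein_sol_equation:
  "(\<lambda>j. real j * r j * stein_sol y (x + j)) sums
     (of_bool (x \<le> y) - measure_pmf.prob q {..y} + real x * stein_sol y x)"
proof -
  define e where "e t = cis t powi (- int y)" for t
  have c: "continuous_on A e" for A
    unfolding e_def by (simp add: cis_power_int) (intro continuous_intros)
  have n: "norm (e t) = 1" for t by (simp add: e_def norm_power_int)
  define I where "I x = integral {-pi..pi} (\<lambda>t. e t * \<Psi> x (cis t))" for x
  let ?T = "\<lambda>j t. of_real (real j * r j) * (e t * \<Psi> (x + j) (cis t))"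
  have bd: "norm (?T j t) \<le> real j * r j * exp (2 * suminf r)" for j t
    using norm_\<Psi>_le[of "cis t" "x + j"] by (auto simp: norm_mult n r_nonneg intro!: mult_left_mono)
  have sb: "summable (\<lambda>j. real j * r j * exp (2 * suminf r))"
    by (intro summable_mult2 summable_mean)
  have cT: "continuous_on {-pi..pi} (?T j)" for j
    by (intro continuous_intros c continuous_\<Psi>_cis)
  note ct = sums_integral_Weierstrass(1)[OF cT bd sb]
  from sums_integral_Weierstrass(2)[OF cT bd sb] have 1: "(\<lambda>j. of_real (real j * r j) * I (x + j)) sums integral {-pi..pi} (\<lambda>t. \<Sum>j. ?T j t)"
    by (simp add: I_def)
  have "integral {-pi..pi} (\<lambda>t. \<Sum>j. ?T j t) - of_nat x * I x =
      integral {-pi..pi} (\<lambda>t. (\<Sum>j. ?T j t) - of_nat x * (e t * \<Psi> x (cis t)))"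
    unfolding I_def
    by (subst integral_diff)
       (auto intro!: integrable_continuous_real continuous_intros ct c continuous_\<Psi>_cis simp del: of_real_mult)
  also have "\<dots> = integral {-pi..pi} (\<lambda>t. e t * K x (cis t))"
  \<comment> \<open>The integrands are compared after cancelling \<open>1 - cis t\<close>, which
    vanishes only at \<open>t = 0\<close>, a null set.\<close>
  proof (rule integral_spike[of "{0}"])
    fix t :: real assume t: "t \<in> {-pi..pi} - {0}"
    have "cis t \<noteq> 1"
    proof
      assume "cis t = 1"
      then have "2 * \<bar>sin (t / 2)\<bar> = 0" using norm_one_minus_cis[of t] by simp
      moreover have "\<bar>t\<bar> \<le> pi" "t \<noteq> 0" using t by auto
      ultimately show False
        using abs_sin_half_bounds(1)[of t] by (simp add: divide_le_0_iff)
    qed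
    have "(\<Sum>j. ?T j t) = (\<Sum>j. e t * (of_real (real j * r j) * \<Psi> (x + j) (cis t)))"
      by (simp add: mult_ac)
    also have "\<dots> = e t * (\<Sum>j. of_real (real j * r j) * \<Psi> (x + j) (cis t))"
      using \<Psi>_jump_sums[of "cis t" x] by (intro suminf_mult) (auto simp: sums_iff)
    finally have "(\<Sum>j. ?T j t) - of_nat x * (e t * \<Psi> x (cis t)) =
        e t * ((\<Sum>j. of_real (real j * r j) * \<Psi> (x + j) (cis t)) - of_nat x * \<Psi> x (cis t))"
      by (simp add: algebra_simps)
    also have "(\<Sum>j. of_real (real j * r j) * \<Psi> (x + j) (cis t)) - of_nat x * \<Psi> x (cis t) = K x (cis t)"
    proof -
      have "(1 - cis t) * ((\<Sum>j. of_real (real j * r j) * \<Psi> (x + j) (cis t)) - of_nat x * \<Psi> x (cis t)) =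
          (1 - cis t) * K x (cis t)"
        unfolding K_eq[of "cis t" x, simplified] by (rule \<Psi>_stein) simp
      then show ?thesis
        using \<open>cis t \<noteq> 1\<close> by (simp only: mult_cancel_left) simp
    qed
    finally show "e t * K x (cis t) = (\<Sum>j. ?T j t) - of_nat x * (e t * \<Psi> x (cis t))" ..
  qed auto
  finally have 2: "integral {-pi..pi} (\<lambda>t. \<Sum>j. ?T j t) = integral {-pi..pi} (\<lambda>t. e t * K x (cis t)) + of_nat x * I x"
    by (simp add: algebra_simps)
  have "(\<lambda>m. 2 * pi * (pmf q m * (of_bool (x \<le> y) - of_bool (m \<le> y)))) sums Re (integral {-pi..pi} (\<lambda>t. e t * K x (cis t)))"
    using sums_Re[OF integral_K[of x y]] unfolding e_def by simp
  \<comment> \<open>All masses add up to \<open>1\<close>, and those with \<open>m \<le> y\<close>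
    to the distribution function at \<open>y\<close>.\<close>
  moreover have "(\<lambda>m. 2 * pi * (pmf q m * (of_bool (x \<le> y) - of_bool (m \<le> y)))) sums (2 * pi * (1 * of_bool (x \<le> y) - measure_pmf.prob q {..y}))"
  proof -
    have "(\<lambda>m. if m \<in> {..y} then pmf q m else 0) sums (\<Sum>m\<in>{..y}. pmf q m)"
      by (rule sums_If_finite_set) simp
    moreover have "(\<lambda>m. if m \<in> {..y} then pmf q m else 0) = (\<lambda>m. pmf q m * of_bool (m \<le> y))" by auto
    moreover have "pmf q sums 1" using sums_Re[OF pgf[of 1]] by simp
    ultimately show ?thesis
      unfolding right_diff_distrib[of "pmf q _"]
      by (intro sums_mult sums_diff sums_mult2) (simp_all add: measure_measure_pmf_finite)
  qed
  ultimately have 3: "Re (integral {-pi..pi} (\<lambda>t. e t * K x (cis t))) = 2 * pi * (of_bool (x \<le> y) - measure_pmf.prob q {..y})"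
    by (simp add: sums_unique2)
  have "(\<lambda>j. real j * r j * Re (I (x + j)) / (2 * pi)) sums
      ((2 * pi * (of_bool (x \<le> y) - measure_pmf.prob q {..y}) + real x * Re (I x)) / (2 * pi))"
    using sums_divide[OF sums_Re[OF 1], of "2 * pi"] unfolding 2 by (simp add: 3)
  moreover have "Re (I x) = 2 * pi * stein_sol y x" for x
    by (simp add: I_def stein_sol_def e_def)
  moreover have "(2 * pi * a + real x * (2 * pi * b)) / (2 * pi) = a + real x * b" for a b
    by (simp add: field_simps)
  ultimately have "(\<lambda>j. real j * r j * (2 * pi * stein_sol y (x + j)) / (2 * pi)) sums
      (of_bool (x \<le> y) - measure_pmf.prob q {..y} + real x * stein_sol y x)"
    by (simp only:)
  moreover have "real j * r j * (2 * pi * s) / (2 * pi) = real j * r j * s" for j s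
    by simp
  ultimately show ?thesis by (simp only:)
qed

end

section \<open>Bounds and uniqueness\<close>

text \<open>The assumption \<open>decay\<close> is the logarithmic form of the bound for
  \<open>\<bar>G z / G w\<bar>\<close>; \<open>d\<close> will be instantiated by
  \<open>delta\<close>.\<close>

locale decaying_jump_rates_law = jump_rates_law +
  fixes d :: real
  assumes d_pos: "d > 0"
    and decay: "\<bar>t\<bar> \<le> pi \<Longrightarrow> 0 \<le> p \<Longrightarrow> p \<le> 1 \<Longrightarrow>
      Re (L (cis t) - L (W (cis t) p)) \<le> - (d * (1 - cos t) * p)"
begin

section \<open>Decay of \<open>\<Psi>\<close> and its differences on the unit circle\<close>

lemma norm_exp_L_decay:
  assumes "\<bar>t\<bar> \<le> pi" "0 \<le> p" "p \<le> 1"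
  shows "norm (exp (L (cis t) - L (W (cis t) p))) \<le> exp (- (d * (1 - cos t) * p))"
  using decay[OF assms] by (simp add: norm_exp_eq_Re)

text \<open>The power of \<open>W\<close> has norm at most \<open>1\<close>, so
  \<open>integral_exp_bound\<close> applies with \<open>a = d * (1 - cos t)\<close>, and Jordan's
  inequality bounds \<open>a\<close> below by a multiple of \<open>t\<^sup>2\<close>.\<close>

lemma norm_\<Psi>_decay:
  assumes "\<bar>t\<bar> \<le> pi"
  shows "norm (\<Psi> x (cis t)) \<le> 2 / (1 + 2 * d / pi\<^sup>2 * t\<^sup>2)"
proof -
  define a where "a = d * (1 - cos t)"
  have a: "2 * d / pi\<^sup>2 * t\<^sup>2 \<le> a" "0 \<le> a"
  proof -
    have "(\<bar>t\<bar> / pi)\<^sup>2 \<le> \<bar>sin (t / 2)\<bar>\<^sup>2"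
      using abs_sin_half_bounds(1)[OF assms] by (intro power_mono) auto
    then have "2 * d * (t\<^sup>2 / pi\<^sup>2) \<le> 2 * d * (sin (t / 2))\<^sup>2"
      using d_pos by (intro mult_left_mono) (auto simp: power_divide)
    then show "2 * d / pi\<^sup>2 * t\<^sup>2 \<le> a"
      by (simp add: a_def one_minus_cos_eq mult_ac)
    show "0 \<le> a" using d_pos by (simp add: a_def)
  qed
  have "norm (\<Psi> x (cis t)) \<le> integral {0..1} (\<lambda>p. exp (- (a * p)))"
    unfolding \<Psi>_def
  proof (rule integral_norm_bound_integral)
    show "norm (E x (cis t) p) \<le> exp (- (a * p))" if "p \<in> {0..1}" for p
    proof -
      have "norm (E x (cis t) p) \<le> 1 * exp (- (a * p))"
        unfolding E_def norm_mult norm_power a_def using that assms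
        by (intro mult_mono power_le_one norm_exp_L_decay norm_W_le) auto
      then show ?thesis by simp
    qed
  qed (auto intro!: integrable_continuous_real continuous_E continuous_intros)
  also have "\<dots> \<le> 2 / (1 + a)"
    by (rule integral_exp_bound) (rule a)
  also have "\<dots> \<le> 2 / (1 + 2 * d / pi\<^sup>2 * t\<^sup>2)"
    using a d_pos by (intro divide_left_mono mult_pos_pos add_pos_nonneg) auto
  finally show ?thesis .
qed

lemma norm_\<Psi>_diff_decay:
  assumes "\<bar>t\<bar> \<le> pi" "x \<ge> 1"
  shows "norm (\<Psi> (x + 1) (cis t) - \<Psi> x (cis t)) \<le> \<bar>t\<bar> / (1 + d / pi * t\<^sup>2)"
proof -
  define a where "a = d * (1 - cos t)"
  define s where "s = \<bar>sin (t / 2)\<bar>"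
  have a: "a = 2 * d * s\<^sup>2" by (simp add: a_def s_def one_minus_cos_eq)
  have "0 \<le> a" using d_pos by (simp add: a_def)
  have s: "\<bar>t\<bar> / pi \<le> s" "2 * s \<le> \<bar>t\<bar>" "0 \<le> s"
    using abs_sin_half_bounds[OF assms(1)] by (auto simp: s_def)
  have "norm (\<Psi> (x + 1) (cis t) - \<Psi> x (cis t)) = norm (integral {0..1} (\<lambda>p. E (x + 1) (cis t) p - E x (cis t) p))"
    unfolding \<Psi>_def by (subst integral_diff) (auto intro!: integrable_continuous_real continuous_E)
  also have "\<dots> \<le> integral {0..1} (\<lambda>p. 2 * s * ((1 - p) * exp (- (a * p))))"
  proof (rule integral_norm_bound_integral)
    fix p :: real assume p: "p \<in> {0..1}"
    \<comment> \<open>Since \<open>x \<ge> 1\<close>, the exponents \<open>x\<close> and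
      \<open>x - 1\<close> really differ by one, and the factor \<open>W (cis t) p - 1\<close>
      splits off.\<close>
    have "E (x + 1) (cis t) p - E x (cis t) p =
        W (cis t) p ^ (x - 1) * (W (cis t) p - 1) * exp (L (cis t) - L (W (cis t) p))"
      using assms(2) by (cases x) (auto simp: E_def algebra_simps)
    also have "norm \<dots> \<le> 1 * ((1 - p) * (2 * s)) * exp (- (a * p))"
    proof -
      have "norm (W (cis t) p - 1) = (1 - p) * (2 * s)"
        using p unfolding W_minus_1 norm_mult norm_of_real norm_minus_commute[of "cis t"]
        by (simp add: norm_one_minus_cis s_def)
      then show ?thesis
        unfolding norm_mult norm_power a_def using p assms s
        by (intro mult_mono power_le_one norm_exp_L_decay norm_W_le) auto
    qed
    finally show "norm (E (x + 1) (cis t) p - E x (cis t) p) \<le> 2 * s * ((1 - p) * exp (- (a * p)))"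
      by (simp only: mult_ac mult_1)
  qed (auto intro!: integrable_continuous_real continuous_E continuous_intros)
  also have "\<dots> = 2 * s * integral {0..1} (\<lambda>p. (1 - p) * exp (- (a * p)))"
    by simp
  also have "\<dots> \<le> 2 * s * (1 / (1 + a))"
    using s \<open>0 \<le> a\<close> by (intro mult_left_mono integral_one_minus_exp_bound) auto
  \<comment> \<open>After cross-multiplication the terms without \<open>d\<close> need
    \<open>2 * s \<le> \<bar>t\<bar>\<close> and those with \<open>d\<close> need
    \<open>\<bar>t\<bar> / pi \<le> s\<close>. Estimating numerator and denominator separately would
    give only \<open>2 * d / pi\<^sup>2\<close> in place of \<open>d / pi\<close>.\<close>
  also have "\<dots> \<le> \<bar>t\<bar> / (1 + d / pi * t\<^sup>2)"
  proof -
    have "(2 * s * d * \<bar>t\<bar>) * (\<bar>t\<bar> / pi) \<le> (2 * s * d * \<bar>t\<bar>) * s"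
      using s d_pos by (intro mult_left_mono) auto
    then have "2 * s * (1 + d / pi * t\<^sup>2) \<le> \<bar>t\<bar> * (1 + a)"
      using s(2) by (simp add: a algebra_simps power2_eq_square)
    moreover have "1 + d / pi * t\<^sup>2 > 0" using d_pos by (intro add_pos_nonneg) auto
    ultimately have "2 * s / (1 + a) \<le> \<bar>t\<bar> / (1 + d / pi * t\<^sup>2)"
      using \<open>0 \<le> a\<close> by (subst frac_le_eq) (auto intro!: divide_nonpos_pos)
    then show ?thesis by simp
  qed
  finally show ?thesis .
qed

text \<open>Integrating \<open>norm_\<Psi>_decay\<close> over the circle gives
  \<open>pi / sqrt (2 * d)\<close>; the stated constant follows from \<open>pi < 4\<close>.\<close>

lemma stein_sol_bound: "\<bar>stein_sol y x\<bar> \<le> 2 * sqrt (2 / d)"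
proof -
  have c: "continuous_on A (\<lambda>t. cis t powi n)" for A n
    by (simp add: cis_power_int) (intro continuous_intros)
  have pos: "2 * d / pi\<^sup>2 > 0" using d_pos by simp
  have nz: "1 + 2 * d / pi\<^sup>2 * t\<^sup>2 \<noteq> 0" for t
    using pos by (smt (verit) mult_nonneg_nonneg zero_le_power2)
  define D where "D = integral {-pi..pi} (\<lambda>t. cis t powi (- int y) * \<Psi> x (cis t))"
  have "norm D \<le> integral {-pi..pi} (\<lambda>t. 2 / (1 + 2 * d / pi\<^sup>2 * t\<^sup>2))"
    unfolding D_def
  proof (rule integral_norm_bound_integral)
    show "norm (cis t powi (- int y) * \<Psi> x (cis t)) \<le> 2 / (1 + 2 * d / pi\<^sup>2 * t\<^sup>2)"
      if "t \<in> {-pi..pi}" for t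
    proof -
      have "\<bar>t\<bar> \<le> pi" using that by auto
      from norm_\<Psi>_decay[OF this] show ?thesis by (simp add: norm_mult norm_power_int)
    qed
    show "(\<lambda>t. cis t powi (- int y) * \<Psi> x (cis t)) integrable_on {-pi..pi}"
      by (intro integrable_continuous_real continuous_intros c continuous_\<Psi>_cis)
    show "(\<lambda>t. 2 / (1 + 2 * d / pi\<^sup>2 * t\<^sup>2)) integrable_on {-pi..pi}"
      using nz by (intro integrable_continuous_real continuous_intros) auto
  qed
  also have "\<dots> \<le> 2 * pi / sqrt (2 * d / pi\<^sup>2)"
    by (rule integral_arctan_bound[OF pos])
  also have "\<dots> = 2 * pi * (pi / sqrt (2 * d))"
    by (simp add: real_sqrt_divide)
  finally have "norm D \<le> 2 * pi * (pi / sqrt (2 * d))" .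
  moreover have "\<bar>Re D / (2 * pi)\<bar> \<le> norm D / (2 * pi)"
    using abs_Re_le_cmod[of D] by (simp add: abs_divide divide_right_mono)
  ultimately have "\<bar>stein_sol y x\<bar> \<le> pi / sqrt (2 * d)"
    unfolding stein_sol_def D_def[symmetric] by (simp add: divide_le_eq mult.commute)
  also have "\<dots> \<le> 4 / sqrt (2 * d)"
    using pi_less_4 d_pos by (intro divide_right_mono) auto
  also have "\<dots> = 2 * sqrt (2 / d)"
  proof -
    have "2 / d = 4 / (2 * d)" by simp
    then have "sqrt (2 / d) = 2 / sqrt (2 * d)" by (simp only: real_sqrt_divide real_sqrt_four)
    then show ?thesis by simp
  qed
  finally show ?thesis .
qed

text \<open>Integrating \<open>norm_\<Psi>_diff_decay\<close> with the logarithmic kernel at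
  \<open>c = d / pi\<close> gives \<open>ln (1 + pi * d) / (2 * d)\<close>.\<close>

lemma stein_sol_diff_bound:
  assumes "x \<ge> 1"
  shows "\<bar>stein_sol y (x + 1) - stein_sol y x\<bar> \<le> 1 / (2 * d) * (1 + log_plus (pi * d))"
proof -
  have c: "continuous_on A (\<lambda>t. cis t powi n)" for A n
    by (simp add: cis_power_int) (intro continuous_intros)
  define D where "D = integral {-pi..pi} (\<lambda>t. cis t powi (- int y) * (\<Psi> (x + 1) (cis t) - \<Psi> x (cis t)))"
  have D: "D = integral {-pi..pi} (\<lambda>t. cis t powi (- int y) * \<Psi> (x + 1) (cis t))
      - integral {-pi..pi} (\<lambda>t. cis t powi (- int y) * \<Psi> x (cis t))"
    unfolding D_def right_diff_distrib
    by (intro integral_diff integrable_continuous_real continuous_intros c continuous_\<Psi>_cis)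
  have pos: "d / pi > 0" using d_pos by simp
  note k = has_integral_log_kernel[OF pos]
  have "norm D \<le> integral {-pi..pi} (\<lambda>t. \<bar>t\<bar> / (1 + d / pi * t\<^sup>2))"
    unfolding D_def
  proof (rule integral_norm_bound_integral)
    show "(\<lambda>t. \<bar>t\<bar> / (1 + d / pi * t\<^sup>2)) integrable_on {-pi..pi}"
      using k by (rule has_integral_integrable)
  qed (use assms norm_\<Psi>_diff_decay[of _ x] in
        \<open>auto simp: norm_mult norm_power_int abs_le_iff
          intro!: integrable_continuous_real continuous_intros c continuous_\<Psi>_cis\<close>)
  also have "\<dots> = ln (1 + d / pi * pi\<^sup>2) / (d / pi)"
    using k by (rule integral_unique)
  also have "\<dots> = 2 * pi * (1 / (2 * d) * ln (1 + pi * d))"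
    using d_pos by (simp add: power2_eq_square mult.commute)
  also have "\<dots> \<le> 2 * pi * (1 / (2 * d) * (1 + log_plus (pi * d)))"
    using d_pos ln_one_plus_le_log_plus[of "pi * d"] by (intro mult_left_mono) auto
  finally have "norm D \<le> 2 * pi * (1 / (2 * d) * (1 + log_plus (pi * d)))" .
  moreover have "stein_sol y (x + 1) - stein_sol y x = Re D / (2 * pi)"
    by (simp add: D stein_sol_def diff_divide_distrib)
  moreover have "\<bar>Re D / (2 * pi)\<bar> \<le> norm D / (2 * pi)"
    using abs_Re_le_cmod[of D] by (simp add: abs_divide divide_right_mono)
  ultimately show ?thesis
    by (simp add: divide_le_eq mult.commute)
qed

end

text \<open>The difference \<open>u\<close> solves the homogeneous equation, so
  \<open>x * \<bar>u x\<bar>\<close> is at most \<open>m\<close> times any bound for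
  \<open>\<bar>u\<bar>\<close> beyond \<open>x\<close>. For large \<open>x\<close> this contracts
  and forces \<open>u x = 0\<close>; the zeros then propagate down to \<open>x = 1\<close>.\<close>

lemma (in jump_rates) stein_solution_unique:
  assumes f: "bounded (range f)" and g: "bounded (range g)" and "f 0 = g 0"
    and fg: "\<And>x. (\<Sum>j. real j * r j * f (x + j)) - real x * f x = (\<Sum>j. real j * r j * g (x + j)) - real x * g x"
  shows "f = g"
proof -
  define m where "m = (\<Sum>j. real j * r j)"
  define u where "u x = f x - g x" for x
  obtain B C where B: "\<And>x. \<bar>f x\<bar> \<le> B" and C: "\<And>x. \<bar>g x\<bar> \<le> C"
    using f g by (auto simp: bounded_iff)
  then have uBC: "\<bar>u x\<bar> \<le> B + C" for x
    using abs_triangle_ineq4[of "f x" "g x"] B[of x] C[of x] unfolding u_def by linarith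
  have sm: "summable (\<lambda>j. real j * r j * h (x + j))" if "\<And>x. \<bar>h x\<bar> \<le> b" for h x and b :: real
    by (rule summable_comparison_test_ev[OF always_eventually summable_mult2[OF summable_mean, of b]])
       (use that in \<open>auto simp: abs_mult r_nonneg intro!: mult_left_mono\<close>)
  have u: "real x * u x = (\<Sum>j. real j * r j * u (x + j))" for x
    using fg[of x] suminf_diff[OF sm[where h = f and x = x, OF B] sm[where h = g and x = x, OF C]] by (simp add: u_def algebra_simps)
  have step: "real x * \<bar>u x\<bar> \<le> m * b" if "\<And>y. y > x \<Longrightarrow> \<bar>u y\<bar> \<le> b" for x b
  proof -
    have le: "norm (real j * r j * u (x + j)) \<le> real j * r j * b" for j
      using that[of "x + j"] r_nonneg[of j] by (cases j) (auto simp: abs_mult intro!: mult_left_mono)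
    have "norm (\<Sum>j. real j * r j * u (x + j)) \<le> (\<Sum>j. real j * r j * b)"
      by (rule norm_suminf_le[OF le]) (intro summable_mult2 summable_mean)
    also have "\<dots> = m * b"
      unfolding m_def by (rule suminf_mult2[symmetric]) (rule summable_mean)
    finally show ?thesis by (simp flip: u add: abs_mult)
  qed
  have m0: "m \<ge> 0" unfolding m_def by (intro suminf_nonneg summable_mean) (simp add: r_nonneg)
  define n where "n = nat \<lceil>2 * m\<rceil> + 1"
  have n: "2 * m < real n" "0 < n" unfolding n_def by linarith+
  \<comment> \<open>Beyond \<open>2 * m\<close> every application of the equation halves a uniform bound.\<close>
  have halve: "\<bar>u x\<bar> \<le> (B + C) / 2 ^ i" if "x \<ge> n" for i x
    using that
  proof (induction i arbitrary: x)
    case (Suc i)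
    have "real x * \<bar>u x\<bar> \<le> m * ((B + C) / 2 ^ i)"
      by (rule step) (use Suc in auto)
    also have "\<dots> \<le> (real x / 2) * ((B + C) / 2 ^ i)"
      using n Suc.prems uBC[of 0] by (intro mult_right_mono) auto
    also have "\<dots> = real x * ((B + C) / 2 ^ Suc i)" by simp
    finally show ?case using n Suc.prems by (simp only: mult_le_cancel_left_pos of_nat_0_less_iff)
  qed (use uBC in auto)
  have tail: "u x = 0" if "x \<ge> n" for x
  proof -
    have "(\<lambda>i. (B + C) * (1 / 2) ^ i) \<longlonglongrightarrow> (B + C) * 0"
      by (intro tendsto_intros LIMSEQ_power_zero) auto
    then have "\<bar>u x\<bar> \<le> (B + C) * 0"
      by (rule tendsto_lowerbound) (use halve[OF that] in \<open>auto simp: power_divide\<close>)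
    then show ?thesis by simp
  qed
  have "u x = 0" if "x \<ge> 1" for x
    using that
  \<comment> \<open>Downward induction from \<open>n\<close>: all later values vanish, so
    \<open>step\<close> applies with bound \<open>0\<close>.\<close>
  proof (induction "n - x" arbitrary: x rule: less_induct)
    case less
    show ?case
    proof (cases "x \<ge> n")
      case False
      have "real x * \<bar>u x\<bar> \<le> m * 0"
        by (rule step) (use less tail False in \<open>force simp: not_le\<close>)
      then show ?thesis using less.prems by (simp add: mult_le_0_iff)
    qed (rule tail)
  qed
  \<comment> \<open>The homogeneous equation does not determine \<open>u 0\<close>; the hypothesis
    on the values at \<open>0\<close> does.\<close>
  then show ?thesis
    using \<open>f 0 = g 0\<close> by (intro ext) (metis One_nat_def Suc_leI neq0_conv right_minus_eq u_def)
qed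

section \<open>The generating function of a compound Poisson law\<close>

lemma integrable_measure_pmf_bounded:
  fixes f :: "'a \<Rightarrow> complex"
  assumes "\<And>x. norm (f x) \<le> B"
  shows "integrable (measure_pmf p) f"
  by (rule measure_pmf.integrable_const_bound[where B = B]) (use assms in auto)

lemma sums_pmf_expectation:
  fixes f :: "nat \<Rightarrow> complex"
  assumes "\<And>n. norm (f n) \<le> B"
  shows "(\<lambda>n. of_real (pmf p n) * f n) sums measure_pmf.expectation p f"
proof -
  have "integrable (count_space UNIV) (\<lambda>n. pmf p n *\<^sub>R f n)"
    using integrable_measure_pmf_bounded[OF assms, of p]
    unfolding measure_pmf_eq_density by (subst (asm) integrable_density) auto
  from sums_integral_count_space_nat[OF this]
  show ?thesis
    unfolding measure_pmf_eq_density by (subst integral_density) (auto simp: scaleR_conv_of_real)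
qed

text \<open>Proved for bounded real functions first, then applied to the real and imaginary
  parts.\<close>

lemma integral_bind_pmf_bounded:
  fixes f :: "'b \<Rightarrow> complex"
  assumes B: "\<And>x. norm (f x) \<le> B"
  shows "measure_pmf.expectation (bind_pmf p N) f =
    measure_pmf.expectation p (\<lambda>x. measure_pmf.expectation (N x) f)"
proof -
  have real: "measure_pmf.expectation (bind_pmf p N) h = measure_pmf.expectation p (\<lambda>x. measure_pmf.expectation (N x) h)"
    if "\<And>x. \<bar>h x\<bar> \<le> B" for h :: "'b \<Rightarrow> real"
    unfolding measure_pmf_bind
    by (rule integral_bind[where K = "count_space UNIV" and B' = 1, OF _ that])
       (auto simp: measure_pmf.emeasure_space_1 measure_pmf_in_subprob_space measure_pmf.finite_measure_axioms)
  note int = integrable_measure_pmf_bounded[OF B]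
  have norm: "norm (measure_pmf.expectation (N x) f) \<le> B" for x
    by (rule order_trans[OF integral_norm_bound], rule measure_pmf.integral_le_const)
       (auto intro: B int)
  note int' = integrable_measure_pmf_bounded[OF norm, of p]
  have "\<bar>Re (f x)\<bar> \<le> B" "\<bar>Im (f x)\<bar> \<le> B" for x
    using abs_Re_le_cmod[of "f x"] abs_Im_le_cmod[of "f x"] B[of x] by linarith+
  from real[OF this(1)] real[OF this(2)] show ?thesis
    by (intro complex_eqI) (simp_all add: int int' flip: integral_Re integral_Im)
qed

text \<open>Conditioning on the first summand \<open>x\<close> splits off the factor
  \<open>z ^ x\<close>; independence makes the factors multiply.\<close>

lemma expectation_power_sum_list_replicate_pmf:
  fixes z :: complex
  assumes "norm z \<le> 1"
  shows "measure_pmf.expectation (map_pmf sum_list (replicate_pmf n p)) (\<lambda>m. z ^ m) =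
    measure_pmf.expectation p (\<lambda>m. z ^ m) ^ n"
proof (induction n)
  case (Suc n)
  have norm: "norm (z ^ m) \<le> 1" for m
    using assms by (simp add: norm_power power_le_one)
  have "map_pmf sum_list (replicate_pmf (Suc n) p) =
      bind_pmf p (\<lambda>x. map_pmf ((+) x) (map_pmf sum_list (replicate_pmf n p)))"
    by (simp add: map_pmf_def bind_assoc_pmf bind_return_pmf)
  also have "measure_pmf.expectation \<dots> (\<lambda>m. z ^ m) =
      measure_pmf.expectation p (\<lambda>x. z ^ x * measure_pmf.expectation (map_pmf sum_list (replicate_pmf n p)) (\<lambda>m. z ^ m))"
    by (subst integral_bind_pmf_bounded[OF norm]) (simp add: power_add)
  also have "\<dots> = measure_pmf.expectation p (\<lambda>m. z ^ m) ^ Suc n"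
    unfolding Suc.IH by (simp add: mult.commute)
  finally show ?case .
qed simp

text \<open>Given the number \<open>n\<close> of summands the expectation is \<open>g ^ n\<close>,
  and averaging over the Poisson weights gives the exponential series of
  \<open>lam * g\<close>.\<close>

lemma expectation_power_compound_poisson_pmf:
  fixes z :: complex
  assumes "norm z \<le> 1" "lam > 0"
  shows "measure_pmf.expectation (compound_poisson_pmf lam mu) (\<lambda>m. z ^ m) =
    exp (of_real lam * (measure_pmf.expectation mu (\<lambda>m. z ^ m) - 1))"
proof -
  define g where "g = measure_pmf.expectation mu (\<lambda>m. z ^ m)"
  have norm: "norm (z ^ m) \<le> 1" for m
    using assms by (simp add: norm_power power_le_one)
  have "norm g \<le> 1"
    unfolding g_def
    by (rule order_trans[OF integral_norm_bound], rule measure_pmf.integral_le_const)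
       (auto intro: norm integrable_measure_pmf_bounded[OF norm])
  then have norm_g: "norm (g ^ n) \<le> 1" for n
    by (simp add: norm_power power_le_one)
  have "measure_pmf.expectation (compound_poisson_pmf lam mu) (\<lambda>m. z ^ m) =
      measure_pmf.expectation (poisson_pmf lam) (\<lambda>n. g ^ n)"
    unfolding compound_poisson_pmf_def
    by (simp only: integral_bind_pmf_bounded[OF norm] expectation_power_sum_list_replicate_pmf[OF assms(1)] g_def)
  moreover have "(\<lambda>n. of_real (pmf (poisson_pmf lam) n) * g ^ n) sums
      measure_pmf.expectation (poisson_pmf lam) (\<lambda>n. g ^ n)"
    by (rule sums_pmf_expectation[OF norm_g])
  moreover have "(\<lambda>n. of_real (pmf (poisson_pmf lam) n) * g ^ n) sums (exp (of_real lam * g) * of_real (exp (- lam)))"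
  proof -
    have "of_real (pmf (poisson_pmf lam) n) * g ^ n =
        (of_real lam * g) ^ n /\<^sub>R fact n * of_real (exp (- lam))" for n
      using assms(2) by (simp add: scaleR_conv_of_real power_mult_distrib divide_inverse mult_ac)
    then show ?thesis
      by (simp only: sums_mult2[OF exp_converges])
  qed
  ultimately have "measure_pmf.expectation (compound_poisson_pmf lam mu) (\<lambda>m. z ^ m) =
      exp (of_real lam * g) * of_real (exp (- lam))"
    by (simp only: sums_unique2)
  then show ?thesis
    by (simp add: g_def right_diff_distrib exp_diff exp_minus divide_inverse flip: exp_of_real)
qed

lemma jump_rates_law_compound_poisson:
  assumes "lam > 0" "pmf mu 0 = 0" "summable (\<lambda>j. real j * (lam * pmf mu j))"
  shows "jump_rates_law (\<lambda>j. lam * pmf mu j) (compound_poisson_pmf lam mu)"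
proof -
  interpret jump_rates "\<lambda>j. lam * pmf mu j"
    by unfold_locales (use assms in auto)
  show ?thesis
  proof unfold_locales
    fix z :: complex assume z: "norm z \<le> 1"
    have norm: "norm (z ^ m) \<le> 1" if "norm z \<le> 1" for m and z :: complex
      using that by (simp add: norm_power power_le_one)
    have L: "L z = of_real lam * measure_pmf.expectation mu (\<lambda>m. z ^ m)" if "norm z \<le> 1" for z
      using sums_mult[OF sums_pmf_expectation[where p = mu, OF norm[OF that]], of "of_real lam"] L_sums[OF that]
      by (auto intro: sums_unique2 simp: mult.assoc)
    have "(\<lambda>m. of_real (pmf (compound_poisson_pmf lam mu) m) * z ^ m) sums
        exp (of_real lam * (measure_pmf.expectation mu (\<lambda>m. z ^ m) - 1))"
      unfolding expectation_power_compound_poisson_pmf[OF z assms(1), symmetric]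
      by (rule sums_pmf_expectation[OF norm[OF z]])
    then show "(\<lambda>m. of_real (pmf (compound_poisson_pmf lam mu) m) * z ^ m) sums exp (L z - L 1)"
      using L[OF z] L[of 1] by (simp add: right_diff_distrib)
  qed
qed

section \<open>Exponential decay from the positivity of delta\<close>

text \<open>On the disc \<open>norm (1 + v) \<le> 1\<close> the Taylor remainder is no larger than
  the first omitted term. By Pascal's rule the remainder for \<open>Suc n\<close> is
  \<open>1 + v\<close> times the one for \<open>n\<close> plus a single monomial.\<close>

lemma norm_truncated_binomial_le:
  fixes v :: complex
  assumes "norm (1 + v) \<le> 1"
  shows "norm ((1 + v) ^ n - (\<Sum>i<k. of_nat (n choose i) * v ^ i)) \<le> real (n choose k) * norm v ^ k"
proof (induction n arbitrary: k)
  case 0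
  have "(\<Sum>i<k. of_nat (0 choose i) * v ^ i) = (if k = 0 then 0 else 1)"
    by (induction k) auto
  then show ?case by auto
next
  case (Suc n)
  show ?case
  proof (cases k)
    case 0
    then show ?thesis using assms by (simp add: norm_power power_le_one flip: power_Suc)
  next
    case (Suc l)
    let ?T = "\<lambda>k. \<Sum>i<k. of_nat (n choose i) * v ^ i"
    have "(\<Sum>i<Suc l. of_nat (Suc n choose i) * v ^ i) = 1 + (\<Sum>i<l. of_nat (Suc n choose Suc i) * v ^ Suc i)"
      by (subst sum.lessThan_Suc_shift) simp
    also have "\<dots> = (1 + (\<Sum>i<l. of_nat (n choose Suc i) * v ^ Suc i)) + v * ?T l"
      by (simp add: sum.distrib sum_distrib_left algebra_simps)
    also have "1 + (\<Sum>i<l. of_nat (n choose Suc i) * v ^ Suc i) = ?T (Suc l)"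
      by (subst sum.lessThan_Suc_shift) simp
    also have "v * ?T l = v * ?T (Suc l) - of_nat (n choose l) * v ^ Suc l"
      by (simp add: algebra_simps)
    finally have "(1 + v) ^ Suc n - (\<Sum>i<Suc l. of_nat (Suc n choose i) * v ^ i) =
        (1 + v) * ((1 + v) ^ n - ?T (Suc l)) + of_nat (n choose l) * v ^ Suc l"
      by (simp add: algebra_simps)
    also have "norm \<dots> \<le> 1 * (real (n choose Suc l) * norm v ^ Suc l) + real (n choose l) * norm v ^ Suc l"
    proof (intro norm_triangle_le add_mono)
      show "norm ((1 + v) * ((1 + v) ^ n - ?T (Suc l))) \<le> 1 * (real (n choose Suc l) * norm v ^ Suc l)"
        unfolding norm_mult by (intro mult_mono assms Suc.IH) auto
    qed (simp add: norm_mult norm_power)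
    also have "\<dots> = real (Suc n choose Suc l) * norm v ^ Suc l"
      by (simp add: algebra_simps)
    finally show ?thesis using Suc by simp
  qed
qed

text \<open>A mean value estimate between \<open>q * u\<close> and \<open>u\<close> for the
  remainder \<open>F\<close> of order \<open>k\<close>. The length of the segment supplies the
  factor \<open>1 - q\<close>, which separate bounds at the two ends would lose; the derivative of
  \<open>F\<close> is \<open>j\<close> times a truncated binomial remainder.\<close>

lemma norm_binomial_diff_le:
  fixes u :: complex
  assumes "norm (1 + u) \<le> 1" "0 \<le> q" "q \<le> 1"
  shows "norm ((1 + u) ^ j - (1 + of_real q * u) ^ j -
      (\<Sum>i<k. of_nat (j choose Suc i) * u ^ Suc i * (1 - of_real q ^ Suc i)))
    \<le> (1 - q) * norm u ^ Suc k * (real j * real (j - 1 choose k))"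
proof -
  \<comment> \<open>A convex set containing both end points, on which
    \<open>norm v \<le> norm u\<close> and \<open>norm (1 + v) \<le> 1\<close> hold.\<close>
  define S :: "complex set" where "S = cball 0 (norm u) \<inter> cball (-1) 1"
  define F where "F v = (1 + v) ^ j - (\<Sum>i<k. of_nat (j choose Suc i) * v ^ Suc i)" for v :: complex
  define F' where "F' v = of_nat j * ((1 + v) ^ (j - 1) - (\<Sum>i<k. of_nat (j - 1 choose i) * v ^ i))" for v :: complex
  have cS: "convex S" unfolding S_def by (intro convex_Int convex_cball)
  have u: "u \<in> S" using assms(1) by (simp add: S_def dist_norm norm_minus_commute add.commute)
  have "0 \<in> S" by (simp add: S_def dist_norm)
  then have qu: "of_real q * u \<in> S"
    using convexD[OF cS u, of 0 q "1 - q"] assms by (simp add: scaleR_conv_of_real)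
  have "norm (F u - F (of_real q * u)) \<le> (real j * (real (j - 1 choose k) * norm u ^ k)) * norm (u - of_real q * u)"
  proof (rule field_differentiable_bound[OF cS _ _ u qu])
    fix v assume v: "v \<in> S"
    have "(F has_field_derivative of_nat j * (1 + v) ^ (j - 1) - (\<Sum>i<k. of_nat (j choose Suc i) * (of_nat (Suc i) * v ^ i))) (at v within S)"
    proof -
      have "((\<lambda>v. (1 + v) ^ j) has_field_derivative of_nat j * (1 + v) ^ (j - 1)) (at v within S)"
        by (auto intro!: derivative_eq_intros)
      moreover have "((\<lambda>v. v ^ Suc i) has_field_derivative of_nat (Suc i) * v ^ i) (at v within S)" for i
        by (rule DERIV_cong[OF DERIV_power[OF DERIV_ident]]) (simp del: power_Suc)
      ultimately show ?thesis
        unfolding F_def by (intro DERIV_diff DERIV_sum DERIV_cmult)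
    qed
    also have "(\<Sum>i<k. of_nat (j choose Suc i) * (of_nat (Suc i) * v ^ i)) = of_nat j * (\<Sum>i<k. of_nat (j - 1 choose i) * v ^ i)"
      unfolding sum_distrib_left
    proof (rule sum.cong)
      fix i
      have "of_nat (Suc i * (j choose Suc i)) = (of_nat (j * (j - 1 choose i)) :: complex)"
        by (simp only: binomial_absorption)
      then show "of_nat (j choose Suc i) * (of_nat (Suc i) * v ^ i) = of_nat j * (of_nat (j - 1 choose i) * v ^ i)"
        by (simp only: of_nat_mult mult.assoc[symmetric]) (simp only: mult_ac)
    qed simp
    finally show "(F has_field_derivative F' v) (at v within S)"
      by (simp add: F'_def right_diff_distrib)
    have v': "norm (1 + v) \<le> 1" "norm v \<le> norm u"
      using v by (auto simp: S_def dist_norm norm_minus_commute add.commute)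
    have "norm (F' v) = real j * norm ((1 + v) ^ (j - 1) - (\<Sum>i<k. of_nat (j - 1 choose i) * v ^ i))"
      by (simp add: F'_def norm_mult)
    also have "\<dots> \<le> real j * (real (j - 1 choose k) * norm v ^ k)"
      by (intro mult_left_mono norm_truncated_binomial_le v') auto
    also have "\<dots> \<le> real j * (real (j - 1 choose k) * norm u ^ k)"
      by (intro mult_left_mono power_mono v') auto
    finally show "norm (F' v) \<le> real j * (real (j - 1 choose k) * norm u ^ k)" .
  qed
  also have "u - of_real q * u = of_real (1 - q) * u" by (simp add: algebra_simps)
  also have "norm (of_real (1 - q) * u) = (1 - q) * norm u"
    using assms unfolding norm_mult norm_of_real by simp
  also have "F u - F (of_real q * u) = (1 + u) ^ j - (1 + of_real q * u) ^ j -
      (\<Sum>i<k. of_nat (j choose Suc i) * u ^ Suc i * (1 - of_real q ^ Suc i))"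
    by (simp add: F_def sum_subtractf algebra_simps power_mult_distrib)
  finally show ?thesis by (simp add: mult_ac)
qed

section \<open>Taylor expansion of \<open>L\<close> about \<open>1\<close>\<close>

lemma falling_factorial_eq_choose: "(\<Prod>r\<le>i. real j - real r) = fact (Suc i) * real (j choose Suc i)"
  unfolding binomial_gbinomial gbinomial_prod_rev
  by (simp add: atLeast0LessThan lessThan_Suc_atMost)

context jump_rates
begin

text \<open>The number \<open>\<theta>\<^sub>i\<close> as a real series; \<open>suminf\<close> has
  its intended value only under summability.\<close>

definition factorial_moment :: "nat \<Rightarrow> real" where
  "factorial_moment i = (\<Sum>j. (\<Prod>l\<le>i. real j - real l) * r j)"

text \<open>Sum \<open>norm_binomial_diff_le\<close> at \<open>u = z - 1\<close> and
  \<open>q = 1 - p\<close> over \<open>j\<close> with weights \<open>r j\<close>. The binomial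
  coefficients sum to factorial moments, and \<open>j * (j - 1 choose k)\<close> is the falling
  factorial divided by \<open>fact k\<close>.\<close>

lemma norm_L_diff_le:
  assumes sm: "\<And>i. i \<le> k \<Longrightarrow> summable (\<lambda>j. (\<Prod>l\<le>i. real j - real l) * r j)"
    and z: "norm z \<le> 1" and p: "0 \<le> p" "p \<le> 1"
  shows "norm (L z - L (W z p) -
      (\<Sum>i<k. (z - 1) ^ Suc i * (1 - of_real (1 - p) ^ Suc i) * of_real (factorial_moment i) / fact (Suc i)))
    \<le> p * norm (z - 1) ^ Suc k * factorial_moment k / fact k"
proof -
  have m: "(\<lambda>j. (\<Prod>l\<le>i. real j - real l) * r j) sums factorial_moment i" if "i \<le> k" for i
    unfolding factorial_moment_def by (intro summable_sums sm that)
  have c: "(\<lambda>j. r j * real (j choose Suc i)) sums (factorial_moment i / fact (Suc i))" if "i \<le> k" for i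
    using sums_divide[OF m[OF that], of "fact (Suc i)"] by (simp add: falling_factorial_eq_choose mult.commute)
  have W: "W z p = 1 + of_real (1 - p) * (z - 1)"
    using W_minus_1[of z p] by (simp add: algebra_simps)
  let ?S = "\<lambda>j. \<Sum>i<k. of_nat (j choose Suc i) * (z - 1) ^ Suc i * (1 - of_real (1 - p) ^ Suc i)"
  have "(\<lambda>j. \<Sum>i<k. of_real (r j * real (j choose Suc i)) * ((z - 1) ^ Suc i * (1 - of_real (1 - p) ^ Suc i))) sums
      (\<Sum>i<k. of_real (factorial_moment i / fact (Suc i)) * ((z - 1) ^ Suc i * (1 - of_real (1 - p) ^ Suc i)))"
    by (intro sums_sum sums_mult2 sums_of_real c) auto
  then have S: "(\<lambda>j. of_real (r j) * ?S j) sums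
      (\<Sum>i<k. (z - 1) ^ Suc i * (1 - of_real (1 - p) ^ Suc i) * of_real (factorial_moment i) / fact (Suc i))"
    by (simp add: sum_distrib_left mult_ac)
  have D: "(\<lambda>j. of_real (r j) * (z ^ j - W z p ^ j - ?S j)) sums
      (L z - L (W z p) -
        (\<Sum>i<k. (z - 1) ^ Suc i * (1 - of_real (1 - p) ^ Suc i) * of_real (factorial_moment i) / fact (Suc i)))"
    using sums_diff[OF sums_diff[OF L_sums[OF z] L_sums[OF norm_W_le[OF z p]]] S]
    by (simp add: right_diff_distrib)
  have B: "norm (of_real (r j) * (z ^ j - W z p ^ j - ?S j)) \<le>
      p * norm (z - 1) ^ Suc k / fact k * ((\<Prod>l\<le>k. real j - real l) * r j)" for j
  proof -
    have "norm (z ^ j - W z p ^ j - ?S j) \<le> p * norm (z - 1) ^ Suc k * (real j * real (j - 1 choose k))"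
      using norm_binomial_diff_le[of "z - 1" "1 - p" j k] z p by (simp add: W)
    also have "real j * real (j - 1 choose k) = real (Suc k * (j choose Suc k))"
      by (simp only: binomial_absorption of_nat_mult)
    also have "\<dots> = (\<Prod>l\<le>k. real j - real l) / fact k"
      by (simp add: falling_factorial_eq_choose field_simps)
    finally have "r j * norm (z ^ j - W z p ^ j - ?S j) \<le>
        r j * (p * norm (z - 1) ^ Suc k * ((\<Prod>l\<le>k. real j - real l) / fact k))"
      by (intro mult_left_mono r_nonneg)
    then show ?thesis by (simp add: norm_mult r_nonneg mult_ac)
  qed
  have "norm (\<Sum>j. of_real (r j) * (z ^ j - W z p ^ j - ?S j)) \<le>
      (\<Sum>j. p * norm (z - 1) ^ Suc k / fact k * ((\<Prod>l\<le>k. real j - real l) * r j))"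
    by (rule norm_suminf_le[OF B]) (intro summable_mult sm order_refl)
  also have "\<dots> = p * norm (z - 1) ^ Suc k / fact k * factorial_moment k"
    unfolding factorial_moment_def by (intro suminf_mult sm order_refl)
  finally show ?thesis using D by (simp add: sums_iff)
qed

end

text \<open>
  The factor \<open>Re ((z - 1) ^ j) / (cos \<phi> - 1)\<close> at \<open>z = cis \<phi>\<close> extends continuously to \<open>\<phi> = 0\<close>
  because \<open>(z - 1)\<^sup>2 = 2 * z * (cos \<phi> - 1)\<close>.
\<close>

definition Re_power_quotient :: "nat \<Rightarrow> real \<Rightarrow> real" where
  "Re_power_quotient i \<phi> = (if i = 0 then 1 else Re (2 * cis \<phi> * (cis \<phi> - 1) ^ (i - 1)))"

lemma Re_cis_minus_1_power: "Re ((cis \<phi> - 1) ^ Suc i) = (cos \<phi> - 1) * Re_power_quotient i \<phi>"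
proof (cases i)
  case (Suc l)
  have "(cis \<phi> - 1)\<^sup>2 = of_real (cos \<phi> - 1) * (2 * cis \<phi>)"
  proof (rule complex_eqI)
    have "(sin \<phi>)\<^sup>2 = 1 - (cos \<phi>)\<^sup>2" by (simp add: sin_squared_eq)
    then show "Re ((cis \<phi> - 1)\<^sup>2) = Re (of_real (cos \<phi> - 1) * (2 * cis \<phi>))"
      by (simp add: power2_eq_square algebra_simps)
  qed (simp add: power2_eq_square algebra_simps)
  moreover have "(cis \<phi> - 1) ^ Suc i = (cis \<phi> - 1)\<^sup>2 * (cis \<phi> - 1) ^ l"
    by (simp add: Suc power2_eq_square)
  ultimately have "(cis \<phi> - 1) ^ Suc i = of_real (cos \<phi> - 1) * (2 * cis \<phi> * (cis \<phi> - 1) ^ l)"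
    by (simp only: mult.assoc)
  then show ?thesis
    by (simp only: Suc Re_power_quotient_def times_complex.sel complex.sel Re_complex_of_real Im_complex_of_real) simp
qed (simp add: Re_power_quotient_def)

text \<open>An explicit continuous form of \<open>g\<^sub>k\<close>: both quotients are replaced by
  expressions without division by \<open>cos \<phi> - 1\<close> or \<open>p\<close>, and the index
  is shifted to \<open>i = j - 1\<close>.\<close>

definition g_ext :: "real \<Rightarrow> nat pmf \<Rightarrow> nat \<Rightarrow> real \<times> real \<Rightarrow> real" where
  "g_ext lam mu k = (\<lambda>(\<phi>, p).
     (\<Sum>i<k. Re_power_quotient i \<phi> / fact (Suc i) * (\<Sum>l<Suc i. (1 - p) ^ l) * enn2real (theta lam mu i))
       - 2 ^ k / fact k * enn2real (theta lam mu k))"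

lemma g_formula_eq_g_ext:
  assumes "\<phi> \<in> {-pi<..pi}" "\<phi> \<noteq> 0" "p \<noteq> 0"
  shows "g_formula lam mu k (\<phi>, p) = g_ext lam mu k (\<phi>, p)"
proof -
  have "\<bar>\<phi>\<bar> \<le> pi" using assms by auto
  from abs_sin_half_bounds(1)[OF this] have "sin (\<phi> / 2) \<noteq> 0"
    using assms by (auto simp: divide_le_0_iff)
  then have "cos \<phi> - 1 \<noteq> 0"
    using one_minus_cos_eq[of \<phi>] by auto
  have "(1 - (1 - p) ^ j) / p = (\<Sum>l<j. (1 - p) ^ l)" for j
    using assms one_diff_power_eq[of "1 - p" j] by simp
  then have "(\<Sum>j = 1..k. Re ((cis \<phi> - 1) ^ j) / fact j * ((1 - (1 - p) ^ j) / p) * enn2real (theta lam mu (j - 1))) =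
      (cos \<phi> - 1) * (\<Sum>i<k. Re_power_quotient i \<phi> / fact (Suc i) * (\<Sum>l<Suc i. (1 - p) ^ l) * enn2real (theta lam mu i))"
    unfolding One_nat_def sum.atLeast1_atMost_eq sum_distrib_left[of "cos \<phi> - 1"]
    by (intro sum.cong) (simp_all add: Re_cis_minus_1_power mult.assoc del: power_Suc fact_Suc sum.lessThan_Suc)
  with \<open>cos \<phi> - 1 \<noteq> 0\<close> show ?thesis
    unfolding g_formula_def g_ext_def case_prod_conv cis_conv_exp[symmetric]
    by (simp del: sum.lessThan_Suc fact_Suc)
qed

lemma continuous_on_g_ext: "continuous_on A (g_ext lam mu k)"
proof -
  have "continuous_on B (Re_power_quotient i)" for B i
  proof (cases "i = 0")
    case False
    then have "Re_power_quotient i = (\<lambda>\<phi>. Re (2 * cis \<phi> * (cis \<phi> - 1) ^ (i - 1)))"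
      by (simp only: Re_power_quotient_def[abs_def] if_False)
    then show ?thesis by (simp only:) (intro continuous_intros)
  qed (simp add: Re_power_quotient_def[abs_def])
  from continuous_on_compose2[OF this[of UNIV] continuous_on_fst]
  show ?thesis
    unfolding g_ext_def case_prod_beta by (auto intro!: continuous_intros simp del: sum.lessThan_Suc)
qed

lemma g_fun_eq_g_ext:
  assumes "\<phi> \<in> {-pi<..pi}" "p \<in> {0..1}"
  shows "g_fun lam mu k (\<phi>, p) = g_ext lam mu k (\<phi>, p)"
proof (cases "\<phi> = 0 \<or> p = 0")
  case True
  let ?S = "({-pi<..pi} - {0}) \<times> {0<..1} :: (real \<times> real) set"
  have "(\<phi>, p) \<in> closure ?S"
  proof -
    have "\<phi> \<in> closure ({-pi<..pi} - {0})"
    proof (cases "\<phi> = 0")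
      case True
      then have "\<phi> \<in> closure {0<..<pi}" by simp
      also have "\<dots> \<subseteq> closure ({-pi<..pi} - {0})" by (intro closure_mono) auto
      finally show ?thesis .
    next
      case False
      then show ?thesis using assms by (intro subsetD[OF closure_subset]) auto
    qed
    moreover have "p \<in> closure {0<..1}"
    proof -
      have "p \<in> closure {0<..<1}" using assms by simp
      also have "\<dots> \<subseteq> closure {0<..1}" by (intro closure_mono) auto
      finally show ?thesis .
    qed
    ultimately show ?thesis by (simp add: closure_Times)
  qed
  \<comment> \<open>The limit must be taken at an accumulation point of \<open>?S\<close>; otherwise
    \<open>Lim\<close> would not be determined.\<close>
  then have lp: "at (\<phi>, p) within ?S \<noteq> bot"
    using True by (auto simp: trivial_limit_within islimpt_in_closure)
  have "(g_ext lam mu k \<longlongrightarrow> g_ext lam mu k (\<phi>, p)) (at (\<phi>, p) within ?S)"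
    using continuous_on_g_ext[of UNIV lam mu k]
    by (auto simp: continuous_on_def intro: tendsto_within_subset)
  moreover have "\<forall>\<^sub>F z in at (\<phi>, p) within ?S. g_ext lam mu k z = g_formula lam mu k z"
    unfolding eventually_at_filter by (intro always_eventually) (auto simp: g_formula_eq_g_ext)
  ultimately have "(g_formula lam mu k \<longlongrightarrow> g_ext lam mu k (\<phi>, p)) (at (\<phi>, p) within ?S)"
    by (rule Lim_transform_eventually)
  then show ?thesis
    using True lp by (simp add: g_fun_def tendsto_Lim)
next
  case False
  then show ?thesis
    using g_formula_eq_g_ext[OF assms(1), of p lam mu k] by (simp add: g_fun_def)
qed

text \<open>An infimum of reals is a lower bound only if the set is bounded below; this holds
  because \<open>g_ext\<close> is continuous on the compact closure of the rectangle.\<close>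

lemma delta_le_g_ext:
  assumes "\<phi> \<in> {-pi<..pi}" "p \<in> {0..1}"
  shows "delta lam mu k \<le> g_ext lam mu k (\<phi>, p)"
proof -
  let ?D = "{-pi<..pi} \<times> {0..1} :: (real \<times> real) set"
  have "bounded (g_ext lam mu k ` ({-pi..pi} \<times> {0..1}))"
    by (intro compact_imp_bounded compact_continuous_image continuous_on_g_ext compact_Times) auto
  then have "bdd_below (g_ext lam mu k ` ?D)"
    by (intro bdd_below_mono[OF bounded_imp_bdd_below] image_mono) auto
  moreover have "delta lam mu k = (INF z\<in>?D. g_ext lam mu k z)"
    unfolding delta_def by (intro INF_cong) (auto simp: g_fun_eq_g_ext)
  ultimately show ?thesis
    using assms by (auto intro!: cINF_lower)
qed

lemma theta_finite:
  assumes "lam > 0" "theta lam mu i < \<infinity>"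
  shows "summable (\<lambda>j. (\<Prod>l\<le>i. real j - real l) * (lam * pmf mu j))"
    and "enn2real (theta lam mu i) = (\<Sum>j. (\<Prod>l\<le>i. real j - real l) * (lam * pmf mu j))"
proof -
  have nonneg: "0 \<le> (\<Prod>l\<le>i. real j - real l) * (lam * pmf mu j)" for j
    using assms by (simp add: falling_factorial_eq_choose del: fact_Suc)
  show sm: "summable (\<lambda>j. (\<Prod>l\<le>i. real j - real l) * (lam * pmf mu j))"
    using assms(2) by (intro summable_suminf_not_top nonneg) (auto simp: theta_def)
  show "enn2real (theta lam mu i) = (\<Sum>j. (\<Prod>l\<le>i. real j - real l) * (lam * pmf mu j))"
    unfolding theta_def by (subst suminf_ennreal2[OF nonneg sm]) (simp add: suminf_nonneg[OF sm nonneg])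
qed

text \<open>With \<open>m = cos t - 1\<close> the Taylor part of \<open>L z - L (W z p)\<close> has
  real part \<open>p * m * (g + 2 ^ k / fact k * \<theta>\<^sub>k)\<close>, where \<open>g\<close>
  is \<open>g_ext\<close> at \<open>(t, p)\<close>. The remainder is at most
  \<open>- p * m * 2 ^ k / fact k * \<theta>\<^sub>k\<close>, so the last term of
  \<open>g\<^sub>k\<close> exactly absorbs it, and \<open>p * m * g\<close> is left.\<close>

lemma decaying_jump_rates_law_compound_poisson:
  assumes "k \<ge> 1" "lam > 0" "pmf mu 0 = 0" "\<forall>i\<le>k. theta lam mu i < \<infinity>" "delta lam mu k > 0"
  shows "decaying_jump_rates_law (\<lambda>j. lam * pmf mu j) (compound_poisson_pmf lam mu) (delta lam mu k)"
proof -
  note th = theta_finite[OF assms(2) assms(4)[rule_format]]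
  interpret jump_rates_law "\<lambda>j. lam * pmf mu j" "compound_poisson_pmf lam mu"
    using th(1)[of 0] by (intro jump_rates_law_compound_poisson assms(2,3)) simp
  have fm: "factorial_moment i = enn2real (theta lam mu i)" if "i \<le> k" for i
    using th(2)[OF that] by (simp add: factorial_moment_def)
  have main: "Re (L (cis t) - L (W (cis t) p)) \<le> - (delta lam mu k * (1 - cos t) * p)"
    if t: "t \<in> {-pi<..pi}" and p: "0 \<le> p" "p \<le> 1" for t p
  proof -
    define z where "z = cis t"
    define m where "m = cos t - 1"
    have m: "m \<le> 0" by (simp add: m_def)
    have nz: "(norm (z - 1))\<^sup>2 = - (2 * m)"
      unfolding z_def m_def norm_minus_commute[of _ 1] norm_one_minus_cis
      using one_minus_cos_eq[of t] by (simp add: power_mult_distrib)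
    let ?S = "\<Sum>i<k. (z - 1) ^ Suc i * (1 - of_real (1 - p) ^ Suc i) * of_real (factorial_moment i) / fact (Suc i)"
    have "Re ?S = (\<Sum>i<k. Re ((z - 1) ^ Suc i) * (1 - (1 - p) ^ Suc i) * factorial_moment i / fact (Suc i))"
    proof -
      have "(z - 1) ^ Suc i * (1 - of_real (1 - p) ^ Suc i) * of_real (factorial_moment i) / fact (Suc i) =
          of_real ((1 - (1 - p) ^ Suc i) * factorial_moment i / fact (Suc i)) * (z - 1) ^ Suc i" for i
        by (simp del: power_Suc fact_Suc)
      moreover have "Re (of_real a * w) = Re w * a" for a w
        by simp
      ultimately have "Re ((z - 1) ^ Suc i * (1 - of_real (1 - p) ^ Suc i) * of_real (factorial_moment i) / fact (Suc i)) =
          Re ((z - 1) ^ Suc i) * ((1 - (1 - p) ^ Suc i) * factorial_moment i / fact (Suc i))" for i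
        by (simp only:)
      then show ?thesis by (simp only: Re_sum times_divide_eq_right mult.assoc)
    qed
    also have "\<dots> = p * m * (\<Sum>i<k. Re_power_quotient i t / fact (Suc i) * (\<Sum>l<Suc i. (1 - p) ^ l) * enn2real (theta lam mu i))"
      unfolding sum_distrib_left[of "p * m"]
    proof (rule sum.cong)
      fix i assume "i \<in> {..<k}"
      moreover have "1 - (1 - p) ^ Suc i = p * (\<Sum>l<Suc i. (1 - p) ^ l)"
        using one_diff_power_eq[of "1 - p" "Suc i"] by simp
      ultimately show "Re ((z - 1) ^ Suc i) * (1 - (1 - p) ^ Suc i) * factorial_moment i / fact (Suc i) =
          p * m * (Re_power_quotient i t / fact (Suc i) * (\<Sum>l<Suc i. (1 - p) ^ l) * enn2real (theta lam mu i))"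
        unfolding z_def Re_cis_minus_1_power m_def by (simp add: fm del: fact_Suc sum.lessThan_Suc power_Suc)
    qed simp
    also have "\<dots> = p * m * (g_ext lam mu k (t, p) + 2 ^ k / fact k * factorial_moment k)"
      by (simp add: g_ext_def fm)
    finally have S: "Re ?S = p * m * (g_ext lam mu k (t, p) + 2 ^ k / fact k * factorial_moment k)" .
    have "Re (L z - L (W z p)) - Re ?S \<le> norm (L z - L (W z p) - ?S)"
      using complex_Re_le_cmod[of "L z - L (W z p) - ?S"] by simp
    also have "\<dots> \<le> p * norm (z - 1) ^ Suc k * factorial_moment k / fact k"
      by (rule norm_L_diff_le) (use th p in \<open>auto simp: z_def\<close>)
    \<comment> \<open>Two of the \<open>k + 1\<close> factors \<open>norm (z - 1)\<close> give
      \<open>- 2 * m\<close>, the other \<open>k - 1\<close> are at most \<open>2\<close>; this is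
      where \<open>k \<ge> 1\<close> enters.\<close>
    also have "\<dots> \<le> p * (2 ^ k * - m) * factorial_moment k / fact k"
    proof -
      obtain l where l: "k = Suc l" using assms(1) by (cases k) auto
      have "norm (z - 1) \<le> 2"
        using norm_triangle_ineq4[of z 1] by (simp add: z_def)
      then have "norm (z - 1) ^ l * (norm (z - 1))\<^sup>2 \<le> 2 ^ l * (norm (z - 1))\<^sup>2"
        by (intro mult_right_mono power_mono) auto
      moreover have "norm (z - 1) ^ l * (norm (z - 1))\<^sup>2 = norm (z - 1) ^ Suc k"
        by (simp add: l power2_eq_square)
      ultimately have "norm (z - 1) ^ Suc k \<le> 2 ^ k * - m"
        by (simp add: l nz)
      moreover have "0 \<le> factorial_moment k" by (simp add: fm)
      ultimately show ?thesis using p by (intro divide_right_mono mult_right_mono mult_left_mono) auto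
    qed
    finally have "Re (L z - L (W z p)) \<le> p * m * g_ext lam mu k (t, p)"
      unfolding S by (simp add: algebra_simps)
    also have "\<dots> \<le> p * m * delta lam mu k"
      using p m delta_le_g_ext[OF t, of p lam mu k] by (intro mult_left_mono_neg) (auto simp: mult_nonneg_nonpos)
    finally show ?thesis by (simp add: z_def m_def algebra_simps)
  qed
  show ?thesis
  proof unfold_locales
    fix t p :: real assume t: "\<bar>t\<bar> \<le> pi" and p: "0 \<le> p" "p \<le> 1"
    show "Re (L (cis t) - L (W (cis t) p)) \<le> - (delta lam mu k * (1 - cos t) * p)"
    \<comment> \<open>The domain of \<open>g\<^sub>k\<close> omits \<open>- pi\<close>, which is the
      same point of the circle as \<open>pi\<close>.\<close>
    proof (cases "t = - pi")
      case True
      then have "cis t = cis pi" "cos t = cos pi" by (simp_all flip: cis_inverse)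
      with main[of pi p] p show ?thesis by simp
    next
      case False
      then have "t \<in> {-pi<..pi}" using t by auto
      from main[OF this p] show ?thesis .
    qed
  qed (rule assms(5))
qed

section \<open>Stein factors\<close>

context decaying_jump_rates_law
begin

text \<open>The value at \<open>0\<close> is reset to match the normalisation in
  \<open>stein_solution\<close>. The equation is unaffected, since the value at \<open>0\<close>
  occurs only with coefficient \<open>0\<close>; uniqueness then identifies the two
  functions.\<close>

lemma stein_solution_eq_stein_sol:
  fixes M :: "'a measure" and U :: "'a \<Rightarrow> nat"
  assumes U: "U \<in> measurable M (count_space UNIV)" "distr M (count_space UNIV) U = measure_pmf q"
    and r: "r = (\<lambda>j. lam * pmf mu j)"
  shows "stein_solution M U lam mu (\<lambda>x. of_bool (x \<le> y)) = (\<lambda>x. if x = 0 then 0 else stein_sol y x)"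
    (is "_ = ?f")
proof -
  let ?h = "\<lambda>x. of_bool (x \<le> y) :: real"
  have "integral\<^sup>L M (\<lambda>\<omega>. ?h (U \<omega>)) = measure_pmf.expectation q ?h"
    unfolding U(2)[symmetric] by (rule integral_distr[symmetric]) (use U(1) in auto)
  also have "\<dots> = measure_pmf.expectation q (indicator {..y})"
    by (intro arg_cong[where f = "measure_pmf.expectation q"]) (auto simp: indicator_def)
  finally have EU: "integral\<^sup>L M (\<lambda>\<omega>. ?h (U \<omega>)) = measure_pmf.prob q {..y}"
    by simp
  have eq: "stein_equation M U lam mu ?h ?f"
    unfolding stein_equation_def EU
  proof
    fix x
    have "real j * (lam * pmf mu j) * ?f (x + j) = real j * r j * stein_sol y (x + j)" for j
      by (cases j) (auto simp: r)
    moreover have "real x * ?f x = real x * stein_sol y x" by simp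
    ultimately show "?h x - measure_pmf.prob q {..y} =
        (\<Sum>j. real j * (lam * pmf mu j) * ?f (x + j)) - real x * ?f x"
      using stein_sol_equation[of y x] by (simp only: sums_iff)
  qed
  have bd: "bounded (range ?f)"
    unfolding bounded_iff
    by (intro exI[of _ "2 * sqrt (2 / d)"]) (use stein_sol_bound[of y] d_pos in auto)
  show ?thesis
    unfolding stein_solution_def
  proof (rule the_equality)
    fix g assume g: "g 0 = 0 \<and> bounded (range g) \<and> stein_equation M U lam mu ?h g"
    have "(\<Sum>j. real j * r j * g (x + j)) - real x * g x = (\<Sum>j. real j * r j * ?f (x + j)) - real x * ?f x" for x
      using g eq unfolding stein_equation_def r by metis
    then show "g = ?f"
      using g bd by (intro stein_solution_unique) simp_all
  qed (use eq bd in simp)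
qed

end

theorem theorem2:
  fixes M :: "'a measure" and U :: "'a \<Rightarrow> nat"
    and lam :: real and mu :: "nat pmf" and k :: nat
  assumes "k \<ge> 1"
    and "lam > 0"
    and "pmf mu 0 = 0"
    and "prob_space M"
    and "compound_poisson_rv M U lam mu"
    and "theta lam mu 0 < \<infinity>"
    and "\<forall>i\<le>k. theta lam mu i < \<infinity>"
    and "delta lam mu k > 0"
  shows "stein_factor 0 M U lam mu \<le> ereal (2 * sqrt (2 / delta lam mu k)) \<and>
         stein_factor 1 M U lam mu \<le>
           ereal (1 / (2 * delta lam mu k) * (1 + log_plus (pi * delta lam mu k)))"
proof -
  interpret decaying_jump_rates_law "\<lambda>j. lam * pmf mu j" "compound_poisson_pmf lam mu" "delta lam mu k"
    by (rule decaying_jump_rates_law_compound_poisson) (use assms in auto)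
  have sol: "stein_solution M U lam mu (\<lambda>x. of_bool (x \<le> y)) x = stein_sol y x" if "x \<ge> 1" for x y
    using assms(5) that by (subst stein_solution_eq_stein_sol) (auto simp: compound_poisson_rv_def)
  show ?thesis
    unfolding stein_factor_def kolmogorov_tests_def
  proof (intro conjI SUP_least)
    fix h :: "nat \<Rightarrow> real" and x :: nat
    assume "h \<in> {h. \<exists>y. h = (\<lambda>x. of_bool (x \<le> y))}" and x: "x \<in> {1..}"
    then obtain y where h: "h = (\<lambda>x. of_bool (x \<le> y))" by auto
    show "ereal \<bar>(fwd_diff ^^ 0) (stein_solution M U lam mu h) x\<bar> \<le> ereal (2 * sqrt (2 / delta lam mu k))"
      using x stein_sol_bound[of y x] by (simp add: h sol)
    show "ereal \<bar>(fwd_diff ^^ 1) (stein_solution M U lam mu h) x\<bar> \<le>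
        ereal (1 / (2 * delta lam mu k) * (1 + log_plus (pi * delta lam mu k)))"
      using x stein_sol_diff_bound[of x y] by (simp add: h sol fwd_diff_def)
  qed
qed

end
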